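(* Let $\Delta$ be a finite labelled simplicial graph (defining graph), with Artin group $G=G(\Delta)$, Coxeter group $W=W(\Delta)$, Deligne complex $\mathbb D$ and Davis complex $\mathbb D_W$, both complexes being equipped with the Moussong metric. Then the inclusion $\mathbb D_W\hookrightarrow\mathbb D$ induced by the Tits section is an isometric embedding. In particular, if $\mathbb D$ is Gromov hyperbolic, then so is $\mathbb D_W$.
   Context: **Artin and Coxeter groups.** A defining graph is a finite simplicial graph $\Delta$ with vertex set $V(\Delta)$ and edge set $E(\Delta)$, in which each edge $\{s,t\}$ carries a label $m_{st}\in\{2,3,4,\dots\}$. The Artin group $G=G(\Delta)$ has generating set $V(\Delta)$ and, for each edge $\{s,t\}\in E(\Delta)$, one relation $ststs\cdots = tstst\cdots$ (both words alternating, of length $m_{st}$); there is no relation between $s$ and $t$ if they do not span an edge. The Coxeter group $W=W(\Delta)$ is obtained by adding the relations $s^2=1$ for all $s\in V(\Delta)$. For $T\subseteq V(\Delta)$, $G_T$ and $W_T$ are the subgroups of $G$, $W$ generated by $T$ (trivial if $T=\emptyset$). Put $\mathcal V_f=\{T\subseteq V(\Delta) : W_T\text{ is finite}\}$. **Deligne and Davis complexes.** The Deligne complex $\mathbb D$ (resp. Davis complex $\mathbb D_W$) is the simplicial complex whose vertices are the cosets $gG_T$, $g\in G$ (resp. $wW_T$, $w\in W$), with $T\in\mathcal V_f$, and whose simplices are the finite chains of such cosets, totally ordered by inclusion. $G$ (resp. $W$) acts by left multiplication, in both cases with fundamental domain the finite complex $K$, the geometric realisation of the poset $\mathcal V_f$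 (identify $T$ with $G_T$, resp. $W_T$). **Tits section.** The Tits section is the map of sets $\tau:W\to G$ sending $w\in W$, written as any reduced word $s_1\cdots s_k$ in $V(\Delta)$, to the element of $G$ represented by the same word $s_1\cdots s_k$ (well defined; a setwise section of the canonical projection $G\to W$). It induces the simplicial inclusion $\mathbb D_W\hookrightarrow\mathbb D$ given on vertices as follows: the coset $wW_T$ is sent to $\tau(w)G_T$. **Moussong metric.** For $R\in\mathcal V_f$ let $E_R$ be the Euclidean space with basis $\{e_s:s\in R\}$ and inner product $\langle e_s,e_s\rangle=1$, $\langle e_s,e_t\rangle=-\cos(\pi/m_{st})$, on which $W_R$ acts by letting $s$ act as reflection in $e_s^\perp$. Let $x_R\in E_R$ be the point with $\langle x_R,e_s\rangle=1$ for all $s\in R$, and for $T\subseteq R$ let $v^R_T$ be the centroid of the orbit $W_T\,x_R$ (so $v^R_\emptyset=x_R$, $v^R_R=0$). The Moussong metric gives the simplex of $K$ corresponding to a chain $R_0\subset R_1\subset\dots\subset R_n$ in $\mathcal V_f$ the metric of the Euclidean simplex with vertices $v^{R_n}_{R_0},\dots,v^{R_n}_{R_n}$; it is extended equivariantly to $\mathbb D$ and to $\mathbb D_W$ as a length metric in each case. *)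

theory Defs
  imports Complex_Main "HOL-Library.FuncSet" "HOL-Algebra.Coset" "HOL-Algebra.Generated_Groups"
begin

section \<open>Groups given by generators and relations\<close>

text \<open>A letter \<open>(s, True)\<close> stands for the generator \<open>s\<close> and \<open>(s, False)\<close> for its formal inverse.
  A relation is a pair of words \<open>(u, v)\<close>, read as \<open>u = v\<close>.\<close>

type_synonym 'v word = "('v \<times> bool) list"

abbreviation words :: "'v set \<Rightarrow> 'v word set"
  where "words S \<equiv> lists (S \<times> UNIV)"

definition positive_word :: "'v list \<Rightarrow> 'v word"
  where "positive_word ws = map (\<lambda>s. (s, True)) ws"

inductive word_eq :: "'v set \<Rightarrow> ('v word \<times> 'v word) set \<Rightarrow> 'v word \<Rightarrow> 'v word \<Rightarrow> bool"
  for S :: "'v set" and R :: "('v word \<times> 'v word) set" where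
  refl: "w \<in> words S \<Longrightarrow> word_eq S R w w"
| sym: "word_eq S R u w \<Longrightarrow> word_eq S R w u"
| trans: "word_eq S R u v \<Longrightarrow> word_eq S R v w \<Longrightarrow> word_eq S R u w"
| cancel: "\<lbrakk>a \<in> words S; b \<in> words S; s \<in> S\<rbrakk> \<Longrightarrow> word_eq S R (a @ [(s, e), (s, \<not> e)] @ b) (a @ b)"
| relation: "\<lbrakk>a \<in> words S; b \<in> words S; (u, v) \<in> R; u \<in> words S; v \<in> words S\<rbrakk>
    \<Longrightarrow> word_eq S R (a @ u @ b) (a @ v @ b)"

definition word_class :: "'v set \<Rightarrow> ('v word \<times> 'v word) set \<Rightarrow> 'v word \<Rightarrow> 'v word set"
  where "word_class S R w = {u. word_eq S R w u}"

definition presented_group :: "'v set \<Rightarrow> ('v word \<times> 'v word) set \<Rightarrow> 'v word set monoid"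
  where "presented_group S R =
    \<lparr>carrier = word_class S R ` words S,
     mult = (\<lambda>X Y. {w. \<exists>x\<in>X. \<exists>y\<in>Y. word_eq S R (x @ y) w}),
     one = word_class S R []\<rparr>"

lemma word_eq_words: "word_eq S R u v \<Longrightarrow> u \<in> words S \<and> v \<in> words S"
  by (induction rule: word_eq.induct) auto

lemma word_eq_append:
  assumes "word_eq S R u v" "a \<in> words S" "b \<in> words S"
  shows "word_eq S R (a @ u @ b) (a @ v @ b)"
  using assms(1)
proof (induction rule: word_eq.induct)
  case (refl w)
  then show ?case using assms(2,3) by (intro word_eq.refl) auto
next
  case (cancel a' b' s e)
  then show ?case
    using word_eq.cancel[of "a @ a'" S "b' @ b" s R e] assms(2,3) by auto
next
  case (relation a' b' u v)
  then show ?case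
    using word_eq.relation[of "a @ a'" S "b' @ b" u v R] assms(2,3) by auto
qed (blast intro: word_eq.sym word_eq.trans)+

lemma word_class_eq_iff:
  assumes "u \<in> words S"
  shows "word_class S R u = word_class S R v \<longleftrightarrow> word_eq S R u v"
  using assms unfolding word_class_def by (blast intro: word_eq.intros(1-3))

lemma presented_group_mult:
  assumes "u \<in> words S" "v \<in> words S"
  shows "word_class S R u \<otimes>\<^bsub>presented_group S R\<^esub> word_class S R v = word_class S R (u @ v)"
proof -
  have "word_eq S R (u @ v) (x @ y)" if "word_eq S R u x" "word_eq S R v y" for x y
    using word_eq_append[OF that(1), of "[]" v] word_eq_append[OF that(2), of x "[]"] that
      word_eq_words[OF that(1)] assms by (auto intro: word_eq.trans)
  with assms show ?thesis
    unfolding presented_group_def word_class_def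
    by (auto intro: word_eq.intros(1-3))
qed

lemma group_presented_group: "group (presented_group S R)"
proof (rule groupI)
  let ?G = "presented_group S R"
  have c: "carrier ?G = word_class S R ` words S" and o: "\<one>\<^bsub>?G\<^esub> = word_class S R []"
    by (simp_all add: presented_group_def)
  show "x \<otimes>\<^bsub>?G\<^esub> y \<in> carrier ?G" if "x \<in> carrier ?G" "y \<in> carrier ?G" for x y
    using that unfolding c
    by (elim imageE) (simp add: presented_group_mult append_in_lists_conv del: in_lists_conv_set)
  show "\<one>\<^bsub>?G\<^esub> \<in> carrier ?G" by (auto simp: c o)
  show "x \<otimes>\<^bsub>?G\<^esub> y \<otimes>\<^bsub>?G\<^esub> z = x \<otimes>\<^bsub>?G\<^esub> (y \<otimes>\<^bsub>?G\<^esub> z)"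
    if "x \<in> carrier ?G" "y \<in> carrier ?G" "z \<in> carrier ?G" for x y z
    using that unfolding c by (elim imageE) (simp add: presented_group_mult append_in_lists_conv del: in_lists_conv_set)
  show "\<one>\<^bsub>?G\<^esub> \<otimes>\<^bsub>?G\<^esub> x = x" if "x \<in> carrier ?G" for x
    using that unfolding c o by (elim imageE) (simp add: presented_group_mult append_in_lists_conv del: in_lists_conv_set)
  show "\<exists>y\<in>carrier ?G. y \<otimes>\<^bsub>?G\<^esub> x = \<one>\<^bsub>?G\<^esub>" if "x \<in> carrier ?G" for x
  proof -
    from that obtain w where w: "w \<in> words S" "x = word_class S R w" by (auto simp: c)
    have "\<exists>u\<in>words S. word_eq S R (u @ w) []" using w(1)
    proof (induction w)
      case Nil
      then show ?case by (auto intro!: bexI[of _ "[]"] word_eq.refl)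
    next
      case (Cons l w)
      then obtain u where u: "u \<in> words S" "word_eq S R (u @ w) []" by auto
      obtain s e where l: "l = (s, e)" by (cases l)
      from Cons.hyps have s: "s \<in> S" "w \<in> words S" by (auto simp: l)
      have "word_eq S R (u @ [(s, \<not> e), (s, \<not> \<not> e)] @ w) (u @ w)"
        by (rule word_eq.cancel) (use u s in auto)
      then have "word_eq S R ((u @ [(s, \<not> e)]) @ l # w) []"
        using u(2) by (auto simp: l intro: word_eq.trans)
      then show ?case using u s by (intro bexI[of _ "u @ [(s, \<not> e)]"]) auto
    qed
    then obtain u where u: "u \<in> words S" "word_eq S R (u @ w) []" by blast
    then have "word_class S R u \<otimes>\<^bsub>?G\<^esub> x = \<one>\<^bsub>?G\<^esub>"
      using w by (simp add: presented_group_mult o word_class_eq_iff)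
    then show ?thesis using u by (auto simp: c)
  qed
qed


section \<open>Artin and Coxeter groups\<close>

record 'v labelled_graph =
  verts :: "'v set"
  edges :: "'v set set"
  edge_label :: "'v set \<Rightarrow> nat"

definition defining_graph :: "'v labelled_graph \<Rightarrow> bool"
  where "defining_graph \<Delta> \<longleftrightarrow> finite (verts \<Delta>) \<and>
    (\<forall>e\<in>edges \<Delta>. e \<subseteq> verts \<Delta> \<and> card e = 2 \<and> 2 \<le> edge_label \<Delta> e)"

fun alternating :: "'v \<Rightarrow> 'v \<Rightarrow> nat \<Rightarrow> 'v list" where
  "alternating s t 0 = []"
| "alternating s t (Suc n) = s # alternating t s n"

definition artin_relations :: "'v labelled_graph \<Rightarrow> ('v word \<times> 'v word) set"
  where "artin_relations \<Delta> =
    {(positive_word (alternating s t (edge_label \<Delta> {s, t})),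
      positive_word (alternating t s (edge_label \<Delta> {s, t}))) | s t. {s, t} \<in> edges \<Delta>}"

definition coxeter_relations :: "'v labelled_graph \<Rightarrow> ('v word \<times> 'v word) set"
  where "coxeter_relations \<Delta> =
    artin_relations \<Delta> \<union> {(positive_word [s, s], []) | s. s \<in> verts \<Delta>}"

definition artin_group :: "'v labelled_graph \<Rightarrow> 'v word set monoid"
  where "artin_group \<Delta> = presented_group (verts \<Delta>) (artin_relations \<Delta>)"

definition coxeter_group :: "'v labelled_graph \<Rightarrow> 'v word set monoid"
  where "coxeter_group \<Delta> = presented_group (verts \<Delta>) (coxeter_relations \<Delta>)"

definition artin_elt :: "'v labelled_graph \<Rightarrow> 'v list \<Rightarrow> 'v word set"
  where "artin_elt \<Delta> ws = word_class (verts \<Delta>) (artin_relations \<Delta>) (positive_word ws)"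

definition coxeter_elt :: "'v labelled_graph \<Rightarrow> 'v list \<Rightarrow> 'v word set"
  where "coxeter_elt \<Delta> ws = word_class (verts \<Delta>) (coxeter_relations \<Delta>) (positive_word ws)"

definition artin_parabolic :: "'v labelled_graph \<Rightarrow> 'v set \<Rightarrow> 'v word set set"
  where "artin_parabolic \<Delta> T = generate (artin_group \<Delta>) ((\<lambda>s. artin_elt \<Delta> [s]) ` T)"

definition coxeter_parabolic :: "'v labelled_graph \<Rightarrow> 'v set \<Rightarrow> 'v word set set"
  where "coxeter_parabolic \<Delta> T = generate (coxeter_group \<Delta>) ((\<lambda>s. coxeter_elt \<Delta> [s]) ` T)"

text \<open>The set \<open>\<V>\<^sub>f\<close>.\<close>

definition spherical_subsets :: "'v labelled_graph \<Rightarrow> 'v set set"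
  where "spherical_subsets \<Delta> = {T. T \<subseteq> verts \<Delta> \<and> finite (coxeter_parabolic \<Delta> T)}"


section \<open>The Deligne and Davis complexes\<close>

text \<open>\<open>P T\<close> is the subgroup attached to \<open>T \<in> F\<close>: for \<open>F = \<V>\<^sub>f\<close>, it is \<open>G\<^sub>T\<close> in the Artin case and
  \<open>W\<^sub>T\<close> in the Coxeter case.\<close>

definition coset_vertices :: "('g, 'b) monoid_scheme \<Rightarrow> ('t \<Rightarrow> 'g set) \<Rightarrow> 't set \<Rightarrow> 'g set set"
  where "coset_vertices H P F = {g <#\<^bsub>H\<^esub> P T | g T. g \<in> carrier H \<and> T \<in> F}"

definition coset_simplices :: "('g, 'b) monoid_scheme \<Rightarrow> ('t \<Rightarrow> 'g set) \<Rightarrow> 't set \<Rightarrow> 'g set set set"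
  where "coset_simplices H P F =
    {\<sigma>. finite \<sigma> \<and> \<sigma> \<noteq> {} \<and> subset.chain (coset_vertices H P F) \<sigma>}"

text \<open>Points of the geometric realisation are given by their barycentric coordinates. The condition
  \<open>sum x \<sigma> = 1\<close> excludes empty and infinite \<open>\<sigma>\<close>.\<close>

definition simplex_points :: "'c set \<Rightarrow> ('c \<Rightarrow> real) set"
  where "simplex_points \<sigma> = {x. (\<forall>c. 0 \<le> x c) \<and> (\<forall>c. c \<notin> \<sigma> \<longrightarrow> x c = 0) \<and> sum x \<sigma> = 1}"

definition realisation :: "'c set set \<Rightarrow> ('c \<Rightarrow> real) set"
  where "realisation \<S> = (\<Union>\<sigma>\<in>\<S>. simplex_points \<sigma>)"

text \<open>The affine extension to realisations of a map \<open>f\<close> between the vertex sets.\<close>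

definition realisation_map :: "('c \<Rightarrow> 'd) \<Rightarrow> ('c \<Rightarrow> real) \<Rightarrow> 'd \<Rightarrow> real"
  where "realisation_map f x = (\<lambda>d. \<Sum>c | x c \<noteq> 0 \<and> f c = d. x c)"

definition deligne_complex :: "'v labelled_graph \<Rightarrow> ('v word set set \<Rightarrow> real) set"
  where "deligne_complex \<Delta> =
    realisation (coset_simplices (artin_group \<Delta>) (artin_parabolic \<Delta>) (spherical_subsets \<Delta>))"

definition davis_complex :: "'v labelled_graph \<Rightarrow> ('v word set set \<Rightarrow> real) set"
  where "davis_complex \<Delta> =
    realisation (coset_simplices (coxeter_group \<Delta>) (coxeter_parabolic \<Delta>) (spherical_subsets \<Delta>))"


section \<open>The Tits section and the induced inclusion\<close>

definition reduced_word :: "'v labelled_graph \<Rightarrow> 'v list \<Rightarrow> bool"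
  where "reduced_word \<Delta> ws \<longleftrightarrow> ws \<in> lists (verts \<Delta>) \<and>
    (\<forall>us\<in>lists (verts \<Delta>). coxeter_elt \<Delta> us = coxeter_elt \<Delta> ws \<longrightarrow> length ws \<le> length us)"

text \<open>The result does not depend on the chosen reduced word, by Matsumoto's theorem.\<close>

definition tits_section :: "'v labelled_graph \<Rightarrow> 'v word set \<Rightarrow> 'v word set"
  where "tits_section \<Delta> w = artin_elt \<Delta> (SOME ws. reduced_word \<Delta> ws \<and> coxeter_elt \<Delta> ws = w)"

definition tits_vertex_map :: "'v labelled_graph \<Rightarrow> 'v word set set \<Rightarrow> 'v word set set"
  where "tits_vertex_map \<Delta> c = (THE d. \<exists>w T. w \<in> carrier (coxeter_group \<Delta>) \<and>
    T \<in> spherical_subsets \<Delta> \<and>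
    c = w <#\<^bsub>coxeter_group \<Delta>\<^esub> coxeter_parabolic \<Delta> T \<and>
    d = tits_section \<Delta> w <#\<^bsub>artin_group \<Delta>\<^esub> artin_parabolic \<Delta> T)"

definition tits_inclusion ::
    "'v labelled_graph \<Rightarrow> ('v word set set \<Rightarrow> real) \<Rightarrow> 'v word set set \<Rightarrow> real"
  where "tits_inclusion \<Delta> = realisation_map (tits_vertex_map \<Delta>)"


section \<open>The Moussong metric\<close>

text \<open>\<open>E\<^sub>R\<close> is the space of coordinate functions supported in \<open>R\<close>, with the bilinear form below;
  the basis vector \<open>e\<^sub>s\<close> is \<open>unit_vec s\<close>. All of this is used for \<open>R \<in> \<V>\<^sub>f\<close> only; then any two
  distinct elements of \<open>R\<close> span an edge, so only labels of edges enter, and the form is positive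
  definite on \<open>E\<^sub>R\<close>.\<close>

definition cosine_coeff :: "'v labelled_graph \<Rightarrow> 'v \<Rightarrow> 'v \<Rightarrow> real"
  where "cosine_coeff \<Delta> s t = (if s = t then 1 else - cos (pi / real (edge_label \<Delta> {s, t})))"

definition cosine_inner :: "'v labelled_graph \<Rightarrow> 'v set \<Rightarrow> ('v \<Rightarrow> real) \<Rightarrow> ('v \<Rightarrow> real) \<Rightarrow> real"
  where "cosine_inner \<Delta> R x y = (\<Sum>s\<in>R. \<Sum>t\<in>R. x s * y t * cosine_coeff \<Delta> s t)"

definition unit_vec :: "'v \<Rightarrow> 'v \<Rightarrow> real"
  where "unit_vec s = (\<lambda>t. if t = s then 1 else 0)"

definition moussong_space :: "'v set \<Rightarrow> ('v \<Rightarrow> real) set"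
  where "moussong_space R = {x. \<forall>s. s \<notin> R \<longrightarrow> x s = 0}"

definition reflection :: "'v labelled_graph \<Rightarrow> 'v set \<Rightarrow> 'v \<Rightarrow> ('v \<Rightarrow> real) \<Rightarrow> 'v \<Rightarrow> real"
  where "reflection \<Delta> R s x = (\<lambda>t. x t - 2 * cosine_inner \<Delta> R x (unit_vec s) * unit_vec s t)"

definition base_point :: "'v labelled_graph \<Rightarrow> 'v set \<Rightarrow> 'v \<Rightarrow> real"
  where "base_point \<Delta> R =
    (THE x. x \<in> moussong_space R \<and> (\<forall>s\<in>R. cosine_inner \<Delta> R x (unit_vec s) = 1))"

text \<open>The orbit \<open>W\<^sub>T x\<close> for \<open>T \<subseteq> R\<close>: the element \<open>s\<^sub>1 \<dots> s\<^sub>k\<close> of \<open>W\<^sub>R\<close> acts as the composition of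
  the reflections in \<open>s\<^sub>1, \<dots>, s\<^sub>k\<close>.\<close>

definition parabolic_orbit ::
    "'v labelled_graph \<Rightarrow> 'v set \<Rightarrow> 'v set \<Rightarrow> ('v \<Rightarrow> real) \<Rightarrow> ('v \<Rightarrow> real) set"
  where "parabolic_orbit \<Delta> R T x =
    {foldr (reflection \<Delta> R) ws x | ws. ws \<in> lists R \<and> coxeter_elt \<Delta> ws \<in> coxeter_parabolic \<Delta> T}"

definition centroid :: "('v \<Rightarrow> real) set \<Rightarrow> 'v \<Rightarrow> real"
  where "centroid A = (\<lambda>t. (\<Sum>y\<in>A. y t) / real (card A))"

definition moussong_vertex :: "'v labelled_graph \<Rightarrow> 'v set \<Rightarrow> 'v set \<Rightarrow> 'v \<Rightarrow> real"
  where "moussong_vertex \<Delta> R T = centroid (parabolic_orbit \<Delta> R T (base_point \<Delta> R))"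

text \<open>The metric on the simplex of \<open>K\<close> given by a finite nonempty chain \<open>\<C>\<close> in \<open>\<V>\<^sub>f\<close>, in barycentric
  coordinates; \<open>\<Union>\<C>\<close> is the largest element \<open>R\<^sub>n\<close> of the chain.\<close>

definition moussong_simplex_dist ::
    "'v labelled_graph \<Rightarrow> 'v set set \<Rightarrow> ('v set \<Rightarrow> real) \<Rightarrow> ('v set \<Rightarrow> real) \<Rightarrow> real"
  where "moussong_simplex_dist \<Delta> \<C> x y =
    (let u = (\<lambda>s. \<Sum>T\<in>\<C>. (x T - y T) * moussong_vertex \<Delta> (\<Union>\<C>) T s)
     in sqrt (cosine_inner \<Delta> (\<Union>\<C>) u u))"

text \<open>\<open>moussong_string \<Delta> H P x y l\<close>: there are points \<open>x = x\<^sub>0, \<dots>, x\<^sub>k = y\<close> such that \<open>x\<^sub>i\<close>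
  and \<open>x\<^sub>i\<^sub>+\<^sub>1\<close> lie in a common translate \<open>g\<C>\<close> of a simplex of \<open>K\<close>, where the distances measured
  in these translates add up to \<open>l\<close>. The length metric of a piecewise Euclidean complex is the
  infimum of the lengths of such strings, i.e. of the lengths of piecewise linear paths.\<close>

inductive moussong_string ::
    "'v labelled_graph \<Rightarrow> ('g, 'b) monoid_scheme \<Rightarrow> ('v set \<Rightarrow> 'g set) \<Rightarrow>
     ('g set \<Rightarrow> real) \<Rightarrow> ('g set \<Rightarrow> real) \<Rightarrow> real \<Rightarrow> bool"
  for \<Delta> :: "'v labelled_graph" and H :: "('g, 'b) monoid_scheme" and P :: "'v set \<Rightarrow> 'g set" where
  start: "x \<in> realisation (coset_simplices H P (spherical_subsets \<Delta>))
    \<Longrightarrow> moussong_string \<Delta> H P x x 0"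
| step: "\<lbrakk>moussong_string \<Delta> H P x y l; g \<in> carrier H;
      finite \<C>; \<C> \<noteq> {}; subset.chain (spherical_subsets \<Delta>) \<C>;
      y \<in> simplex_points ((\<lambda>T. g <#\<^bsub>H\<^esub> P T) ` \<C>); z \<in> simplex_points ((\<lambda>T. g <#\<^bsub>H\<^esub> P T) ` \<C>)\<rbrakk>
    \<Longrightarrow> moussong_string \<Delta> H P x z
          (l + moussong_simplex_dist \<Delta> \<C> (\<lambda>T. y (g <#\<^bsub>H\<^esub> P T)) (\<lambda>T. z (g <#\<^bsub>H\<^esub> P T)))"

definition moussong_dist ::
    "'v labelled_graph \<Rightarrow> ('g, 'b) monoid_scheme \<Rightarrow> ('v set \<Rightarrow> 'g set) \<Rightarrow>
     ('g set \<Rightarrow> real) \<Rightarrow> ('g set \<Rightarrow> real) \<Rightarrow> real"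
  where "moussong_dist \<Delta> H P x y = Inf {l. moussong_string \<Delta> H P x y l}"

definition deligne_dist ::
    "'v labelled_graph \<Rightarrow> ('v word set set \<Rightarrow> real) \<Rightarrow> ('v word set set \<Rightarrow> real) \<Rightarrow> real"
  where "deligne_dist \<Delta> = moussong_dist \<Delta> (artin_group \<Delta>) (artin_parabolic \<Delta>)"

definition davis_dist ::
    "'v labelled_graph \<Rightarrow> ('v word set set \<Rightarrow> real) \<Rightarrow> ('v word set set \<Rightarrow> real) \<Rightarrow> real"
  where "davis_dist \<Delta> = moussong_dist \<Delta> (coxeter_group \<Delta>) (coxeter_parabolic \<Delta>)"


section \<open>Isometric embeddings and Gromov hyperbolicity\<close>

definition isometric_embedding ::
    "'a set \<Rightarrow> ('a \<Rightarrow> 'a \<Rightarrow> real) \<Rightarrow> 'b set \<Rightarrow> ('b \<Rightarrow> 'b \<Rightarrow> real) \<Rightarrow> ('a \<Rightarrow> 'b) \<Rightarrow> bool"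
  where "isometric_embedding X d Y d' f \<longleftrightarrow>
    f \<in> X \<rightarrow> Y \<and> (\<forall>x\<in>X. \<forall>y\<in>X. d' (f x) (f y) = d x y)"

definition gromov_product :: "('a \<Rightarrow> 'a \<Rightarrow> real) \<Rightarrow> 'a \<Rightarrow> 'a \<Rightarrow> 'a \<Rightarrow> real"
  where "gromov_product d w x y = (d x w + d y w - d x y) / 2"

definition gromov_hyperbolic :: "'a set \<Rightarrow> ('a \<Rightarrow> 'a \<Rightarrow> real) \<Rightarrow> bool"
  where "gromov_hyperbolic X d \<longleftrightarrow> (\<exists>\<delta>\<ge>0. \<forall>w\<in>X. \<forall>x\<in>X. \<forall>y\<in>X. \<forall>z\<in>X.
    min (gromov_product d w x y) (gromov_product d w y z) - \<delta> \<le> gromov_product d w x z)"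

end

theory Submission
  imports Defs "HOL-Algebra.Left_Coset"
begin

text \<open>The canonical projection \<open>G \<rightarrow> W\<close> sends \<open>gG\<^sub>T\<close> to \<open>\<pi>(g)W\<^sub>T\<close> and so induces a map
  \<open>\<D> \<rightarrow> \<D>\<^sub>W\<close> which is a left inverse of the inclusion given by the Tits section \<open>\<tau>\<close>. Both maps
  carry a translate \<open>g\<C>\<close> of a simplex of \<open>K\<close> to a translate of the same \<open>\<C>\<close>, without changing
  barycentric coordinates, hence without changing the Moussong distance inside the simplex. So both
  carry a string of points to a string of the same length. As going forth and back is the identity,
  two points of \<open>\<D>\<^sub>W\<close> are joined by strings of exactly the same lengths as their images, and the
  two infima agree (\<open>moussong_dist_retract\<close>). Hyperbolicity then passes to \<open>\<D>\<^sub>W\<close> because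
  the Gromov product is preserved.

  What remains is that both maps exist and respect the types of simplices, and this is where Coxeter
  groups enter.

  First, \<open>W\<^sub>T \<subseteq> W\<^sub>R\<close> must imply \<open>T \<subseteq> R\<close>, so that cosets remember their types. This is read off
  from the contragredient geometric representation: a functional that vanishes on the basis vectors
  of \<open>T\<close> is fixed by \<open>W\<^sub>T\<close>, but the indicator of \<open>s\<close> is not fixed by \<open>s\<close>
  (\<open>parabolic_letter\<close>). The case of \<open>G\<close> follows by projecting to \<open>W\<close>.

  Second, \<open>wW\<^sub>T \<mapsto> \<tau>(w)G\<^sub>T\<close> must be well defined. It suffices to compare \<open>w\<close> with \<open>ws\<close> for
  \<open>s \<in> T\<close>: of the two, the longer one has a reduced word which is a reduced word of the shorter one
  followed by \<open>s\<close>, so \<open>\<tau>(w)\<close> and \<open>\<tau>(ws)\<close> differ by the generator \<open>s\<close> on the right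
  (\<open>tits_right_mult\<close>). This presupposes that \<open>\<tau>\<close> may be computed from any reduced word, which is
  Matsumoto's theorem (\<open>matsumoto\<close>). It rests on the exchange condition, obtained by counting
  reflections modulo 2 (\<open>exchange\<close>), and on the fact that \<open>st\<close> has order exactly \<open>m\<^sub>s\<^sub>t\<close> in
  \<open>W\<close>, obtained from the same representation (\<open>dihedral_order\<close>).\<close>

section \<open>Words in the Coxeter group\<close>

lemma positive_word_append: "positive_word (u @ v) = positive_word u @ positive_word v"
  by (simp add: positive_word_def)

lemma positive_word_map_fst: "map fst (positive_word u) = u"
  by (induction u) (auto simp: positive_word_def)

lemma alternating_length [simp]: "length (alternating s t n) = n"
  by (induction n arbitrary: s t) auto

lemma alternating_add:
  "alternating s t (i + j) = alternating s t i @ (if even i then alternating s t j else alternating t s j)"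
  by (induction i arbitrary: s t) auto

lemma alternating_Suc_right:
  "alternating s t (Suc n) = alternating s t n @ [if even n then s else t]"
  using alternating_add[of s t n 1] by (auto split: if_splits)

lemma rev_alternating:
  "rev (alternating s t n) = (if even n then alternating t s n else alternating s t n)"
proof (induction n arbitrary: s t)
  case (Suc n)
  then show ?case using alternating_Suc_right[of s t n] alternating_Suc_right[of t s n]
    by (auto split: if_splits)
qed simp

lemma alternating_neighbours:
  "alternating s t n = p @ z # y # z' # q \<Longrightarrow> z = z'"
proof (induction p arbitrary: s t n)
  case Nil
  obtain k where "n = Suc (Suc (Suc k))"
    using Nil alternating_length[of s t n] by (metis add_Suc_right append_Nil length_Cons)
  with Nil show ?case by auto
next
  case (Cons x p)
  then obtain k where "n = Suc k" by (cases n) auto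
  with Cons.prems have "alternating t s k = p @ z # y # z' # q" by auto
  then show ?case by (rule Cons.IH)
qed

locale artin_system =
  fixes \<Delta> :: "'v labelled_graph"
  assumes graph: "defining_graph \<Delta>"
begin

abbreviation V where "V \<equiv> verts \<Delta>"
abbreviation W where "W \<equiv> coxeter_group \<Delta>"
abbreviation G where "G \<equiv> artin_group \<Delta>"
abbreviation C where "C \<equiv> coxeter_elt \<Delta>"
abbreviation A where "A \<equiv> artin_elt \<Delta>"
abbreviation m where "m s t \<equiv> edge_label \<Delta> {s, t}"
abbreviation cox where "cox \<equiv> word_eq V (coxeter_relations \<Delta>)"

text \<open>Membership in \<^term>\<open>lists V\<close> is decided along the structure of the word.\<close>

declare in_lists_conv_set [simp del] in_listsI [rule del] in_listsD [rule del]

lemma rev_in_lists [simp]: "rev u \<in> lists V \<longleftrightarrow> u \<in> lists V"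
  by (simp add: in_lists_conv_set)

lemma words_map_fst: "w \<in> words V \<Longrightarrow> map fst w \<in> lists V"
  by (auto simp: in_lists_conv_set)

lemma edgeD:
  assumes "{s, t} \<in> edges \<Delta>"
  shows "s \<in> V" "t \<in> V" "s \<noteq> t" "2 \<le> m s t"
  using assms graph by (force simp: defining_graph_def card_2_iff doubleton_eq_iff)+

lemma positive_word_in: "u \<in> lists V \<Longrightarrow> positive_word u \<in> words V"
  by (auto simp: positive_word_def in_lists_conv_set)

lemma group_W: "group W" and group_G: "group G"
  by (simp_all add: coxeter_group_def artin_group_def group_presented_group)

sublocale W: group W by (rule group_W)
sublocale G: group G by (rule group_G)

lemma C_append: "\<lbrakk>u \<in> lists V; v \<in> lists V\<rbrakk> \<Longrightarrow> C (u @ v) = C u \<otimes>\<^bsub>W\<^esub> C v"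
  using presented_group_mult[OF positive_word_in[of u] positive_word_in[of v]]
  by (simp add: coxeter_elt_def coxeter_group_def positive_word_append)

lemma A_append: "\<lbrakk>u \<in> lists V; v \<in> lists V\<rbrakk> \<Longrightarrow> A (u @ v) = A u \<otimes>\<^bsub>G\<^esub> A v"
  using presented_group_mult[OF positive_word_in[of u] positive_word_in[of v]]
  by (simp add: artin_elt_def artin_group_def positive_word_append)

lemma C_Nil: "C [] = \<one>\<^bsub>W\<^esub>"
  by (simp add: coxeter_elt_def coxeter_group_def presented_group_def positive_word_def)

lemma C_closed: "u \<in> lists V \<Longrightarrow> C u \<in> carrier W"
  using positive_word_in by (simp add: coxeter_elt_def coxeter_group_def presented_group_def)

lemma A_closed: "u \<in> lists V \<Longrightarrow> A u \<in> carrier G"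
  using positive_word_in by (simp add: artin_elt_def artin_group_def presented_group_def)

lemma C_eq_iff: "u \<in> lists V \<Longrightarrow> C u = C v \<longleftrightarrow> cox (positive_word u) (positive_word v)"
  using word_class_eq_iff[OF positive_word_in] by (simp add: coxeter_elt_def)

lemma alternating_in: "\<lbrakk>s \<in> V; t \<in> V\<rbrakk> \<Longrightarrow> alternating s t n \<in> lists V"
  by (induction n arbitrary: s t) auto

lemma C_square: assumes "s \<in> V" shows "C [s, s] = \<one>\<^bsub>W\<^esub>"
proof -
  have "cox ([] @ positive_word [s, s] @ []) ([] @ [] @ [])"
    by (rule word_eq.relation) (use assms in \<open>auto simp: coxeter_relations_def positive_word_def\<close>)
  then show ?thesis
    using assms C_eq_iff[of "[s, s]" "[]"] by (simp add: C_Nil positive_word_def)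
qed

lemma braid_relation_cong:
  assumes "{s, t} \<in> edges \<Delta>"
  shows "C (alternating s t (m s t)) = C (alternating t s (m s t))"
    and "A (alternating s t (m s t)) = A (alternating t s (m s t))"
proof -
  let ?u = "positive_word (alternating s t (m s t))" and ?v = "positive_word (alternating t s (m s t))"
  have uv: "?u \<in> words V" "?v \<in> words V" "(?u, ?v) \<in> artin_relations \<Delta>"
    using assms edgeD[OF assms] by (auto intro!: positive_word_in alternating_in simp: artin_relations_def)
  then have "word_eq V (artin_relations \<Delta>) ([] @ ?u @ []) ([] @ ?v @ [])"
    "cox ([] @ ?u @ []) ([] @ ?v @ [])"
    by (intro word_eq.relation; auto simp: coxeter_relations_def)+
  with uv show "C (alternating s t (m s t)) = C (alternating t s (m s t))"
    "A (alternating s t (m s t)) = A (alternating t s (m s t))"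
    by (simp_all add: coxeter_elt_def artin_elt_def word_class_eq_iff)
qed

text \<open>Since \<open>s\<close> and \<open>s\<inverse>\<close> agree in \<open>W\<close>, signs may be dropped: to define a function on \<open>W\<close>
  it suffices to define one on unsigned words that respects the squares and the braid relations.
  Everything below that is computed from a word of an element of \<open>W\<close> is shown to be
  independent of the word in this way.\<close>

lemma coxeter_invariant:
  assumes sq: "\<And>a b s. \<lbrakk>a \<in> lists V; b \<in> lists V; s \<in> V\<rbrakk> \<Longrightarrow> F (a @ [s, s] @ b) = F (a @ b)"
    and br: "\<And>a b s t. \<lbrakk>a \<in> lists V; b \<in> lists V; {s, t} \<in> edges \<Delta>\<rbrakk>
      \<Longrightarrow> F (a @ alternating s t (m s t) @ b) = F (a @ alternating t s (m s t) @ b)"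
    and uv: "u \<in> lists V" "C u = C v"
  shows "F u = F v"
proof -
  have "F (map fst p) = F (map fst q)" if "cox p q" for p q
    using that
  proof (induction rule: word_eq.induct)
    case (cancel a b s e)
    then show ?case using sq[of "map fst a" "map fst b" s] by (simp add: words_map_fst)
  next
    case (relation a b p q)
    then have ab: "map fst a \<in> lists V" "map fst b \<in> lists V" by (simp_all add: words_map_fst)
    from relation(3) consider
      s t where "{s, t} \<in> edges \<Delta>" "p = positive_word (alternating s t (m s t))"
        "q = positive_word (alternating t s (m s t))"
      | s where "s \<in> V" "p = positive_word [s, s]" "q = []"
      by (auto simp: coxeter_relations_def artin_relations_def)
    then show ?case
    proof cases
      case 1
      then show ?thesis using br[OF ab 1(1)] by (simp add: positive_word_map_fst)
    next
      case 2
      then show ?thesis using sq[OF ab 2(1)] by (simp add: positive_word_map_fst)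
    qed
  qed auto
  from this[of "positive_word u" "positive_word v"] uv show ?thesis
    by (simp add: C_eq_iff positive_word_map_fst)
qed

lemma word_class_drop_signs:
  assumes "w \<in> words V"
  shows "word_class V (coxeter_relations \<Delta>) w = C (map fst w)"
  using assms
proof (induction w)
  case Nil
  then show ?case by (simp add: coxeter_elt_def positive_word_def)
next
  case (Cons l w)
  obtain s e where l: "l = (s, e)" by (cases l)
  let ?R = "coxeter_relations \<Delta>"
  from Cons have s: "s \<in> V" and w: "w \<in> words V" "map fst w \<in> lists V" by (auto simp: l words_map_fst)
  have "word_class V ?R [l] = C [s]"
  proof (cases e)
    case True
    then show ?thesis by (simp add: l coxeter_elt_def positive_word_def)
  next
    case False
    have "cox ([(s, False)] @ [(s, True), (s, True)] @ []) ([(s, False)] @ [] @ [])"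
      by (rule word_eq.relation) (use s in \<open>auto simp: coxeter_relations_def positive_word_def\<close>)
    moreover have "cox ([] @ [(s, False), (s, \<not> False)] @ [(s, True)]) ([] @ [(s, True)])"
      by (rule word_eq.cancel) (use s in auto)
    ultimately have "cox [(s, False)] [(s, True)]"
      by (auto intro: word_eq.sym word_eq.trans)
    with False s show ?thesis
      by (simp add: l coxeter_elt_def positive_word_def word_class_eq_iff)
  qed
  moreover have "word_class V ?R ([l] @ w) = word_class V ?R [l] \<otimes>\<^bsub>W\<^esub> word_class V ?R w"
    using s w by (subst presented_group_mult[symmetric]) (auto simp: coxeter_group_def l)
  ultimately show ?case
    using Cons C_append[of "[s]" "map fst w"] s w by (simp add: l)
qed

lemma carrier_W: "carrier W = C ` lists V"
proof
  show "carrier W \<subseteq> C ` lists V"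
  proof
    fix x assume "x \<in> carrier W"
    then obtain w where w: "w \<in> words V" "x = word_class V (coxeter_relations \<Delta>) w"
      by (auto simp: coxeter_group_def presented_group_def)
    moreover from w have "map fst w \<in> lists V" by (simp add: words_map_fst)
    ultimately show "x \<in> C ` lists V" by (metis word_class_drop_signs imageI)
  qed
qed (use C_closed in auto)

lemma C_rev:
  assumes "u \<in> lists V" shows "C (rev u) = inv\<^bsub>W\<^esub> C u"
proof -
  have "C (rev u @ u) = \<one>\<^bsub>W\<^esub>" using assms
  proof (induction u)
    case (Cons s u)
    then have "C (rev (s # u) @ s # u) = C (rev u) \<otimes>\<^bsub>W\<^esub> C [s, s] \<otimes>\<^bsub>W\<^esub> C u"
      using C_append[of "rev u @ [s, s]" u] C_append[of "rev u" "[s, s]"] by simp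
    also have "\<dots> = C (rev u @ u)"
      using Cons C_closed[of "rev u"] by (subst C_square) (auto simp: C_append)
    finally show ?case using Cons by simp
  qed (simp add: C_Nil)
  then show ?thesis
    using assms C_closed[of "rev u"] C_closed[of u]
    by (intro W.inv_equality[symmetric]) (simp_all add: C_append)
qed

lemma C_cong:
  assumes "u \<in> lists V" "u' \<in> lists V" "C u = C u'" "a \<in> lists V" "b \<in> lists V"
  shows "C (a @ u @ b) = C (a @ u' @ b)"
  using assms by (simp add: C_append)

lemma C_cancel_left:
  assumes "u \<in> lists V" "v \<in> lists V" "a \<in> lists V" "C (a @ u) = C (a @ v)"
  shows "C u = C v"
  using assms C_closed by (simp add: C_append)

lemma C_cancel_right:
  assumes "u \<in> lists V" "v \<in> lists V" "a \<in> lists V" "C (u @ a) = C (v @ a)"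
  shows "C u = C v"
  using assms C_closed by (simp add: C_append)

lemma C_delete_square:
  assumes "s \<in> V" "a \<in> lists V" "b \<in> lists V"
  shows "C (a @ s # s # b) = C (a @ b)"
  using C_cong[of "[s, s]" "[]" a b] assms by (simp add: C_square C_Nil)

lemma C_move_left:
  assumes "s \<in> V" "u \<in> lists V" "v \<in> lists V" "C (s # u) = C v"
  shows "C u = C (s # v)"
  using C_delete_square[of s "[]" u] C_cong[of "s # u" v "[s]" "[]"] assms by simp

end

section \<open>Reduced words and the exchange condition\<close>

text \<open>For \<open>w = s\<^sub>1 \<dots> s\<^sub>k\<close> these are the words \<open>s\<^sub>1 \<dots> s\<^sub>i \<dots> s\<^sub>1\<close>. They represent the reflections
  whose left multiplication deletes a letter from the word.\<close>

fun refls :: "'v list \<Rightarrow> 'v list list" where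
  "refls [] = []"
| "refls (s # u) = [s] # map (\<lambda>r. s # r @ [s]) (refls u)"

lemma refls_append: "refls (u @ v) = refls u @ map (\<lambda>r. u @ r @ rev u) (refls v)"
  by (induction u) auto

lemma refls_alternating: "refls (alternating s t n) = map (\<lambda>i. alternating s t (2 * i + 1)) [0..<n]"
proof (induction n arbitrary: s t)
  case (Suc n)
  have conj: "s # alternating t s (2 * i + 1) @ [s] = alternating s t (2 * Suc i + 1)" for i
    using alternating_Suc_right[of s t "2 * i + 2"] by simp
  have "refls (alternating s t (Suc n)) =
      [s] # map (\<lambda>i. s # alternating t s (2 * i + 1) @ [s]) [0..<n]"
    by (simp add: Suc)
  also have "\<dots> = map (\<lambda>i. alternating s t (2 * i + 1)) [0..<Suc n]"
    by (simp only: conj map_upt_Suc) simp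
  finally show ?case .
qed simp

context artin_system
begin

abbreviation reduced where "reduced \<equiv> reduced_word \<Delta>"

lemma reducedD: "reduced u \<Longrightarrow> u \<in> lists V"
  "reduced u \<Longrightarrow> v \<in> lists V \<Longrightarrow> C v = C u \<Longrightarrow> length u \<le> length v"
  by (auto simp: reduced_word_def)

lemma reduced_same_length:
  "\<lbrakk>reduced u; v \<in> lists V; C v = C u; length v \<le> length u\<rbrakk> \<Longrightarrow> reduced v"
  unfolding reduced_word_def by force

lemma reduced_exists:
  assumes "u \<in> lists V"
  obtains v where "reduced v" "C v = C u"
proof -
  let ?P = "\<lambda>v. v \<in> lists V \<and> C v = C u"
  obtain v where v: "?P v" "\<And>w. ?P w \<Longrightarrow> length v \<le> length w"
    using arg_min_nat_lemma[of ?P u length] assms by blast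
  then have "reduced v" by (simp add: reduced_word_def)
  with v(1) that[of v] show thesis by simp
qed

lemma reduced_infix:
  assumes "reduced (a @ u @ b)" shows "reduced u"
  unfolding reduced_word_def
proof (intro conjI ballI impI)
  show u: "u \<in> lists V" using reducedD(1)[OF assms] by auto
  fix v assume v: "v \<in> lists V" "C v = C u"
  have "length (a @ u @ b) \<le> length (a @ v @ b)"
    using v u reducedD(1)[OF assms] C_cong[of v u a b]
    by (intro reducedD(2)[OF assms]) auto
  then show "length u \<le> length v" by simp
qed

lemma reduced_rev:
  assumes "reduced u" shows "reduced (rev u)"
  unfolding reduced_word_def
proof (intro conjI ballI impI)
  show u: "rev u \<in> lists V" using reducedD(1)[OF assms] by auto
  fix v assume v: "v \<in> lists V" "C v = C (rev u)"
  then have "C (rev v) = inv\<^bsub>W\<^esub> C (rev u)" by (simp add: C_rev)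
  also have "\<dots> = C (rev (rev u))" using u by (simp only: C_rev)
  finally have "C (rev v) = C u" by simp
  then have "length u \<le> length (rev v)"
    using v(1) by (intro reducedD(2)[OF assms]) simp_all
  then show "length (rev u) \<le> length v" by simp
qed

lemma refls_in: "u \<in> lists V \<Longrightarrow> r \<in> set (refls u) \<Longrightarrow> r \<in> lists V"
  by (induction u arbitrary: r) auto

lemma refls_delete:
  assumes "u \<in> lists V" "r \<in> set (refls u)"
  shows "\<exists>a y b. u = a @ y # b \<and> C (r @ u) = C (a @ b)"
  using assms
proof (induction u arbitrary: r)
  case (Cons s u)
  then have s: "s \<in> V" "u \<in> lists V" by auto
  show ?case
  proof (cases "r = [s]")
    case True
    with s show ?thesis
      using C_delete_square[of s "[]" u] by (intro exI[of _ "[]"]) auto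
  next
    case False
    then obtain r' where r': "r' \<in> set (refls u)" "r = s # r' @ [s]" using Cons.prems by auto
    obtain a y b where ayb: "u = a @ y # b" "C (r' @ u) = C (a @ b)" using Cons.IH s r' by blast
    have r'V: "r' \<in> lists V" using refls_in s r' by blast
    have "C (r @ s # u) = C (s # r' @ u)"
      using C_delete_square[of s "s # r'" u] s r'V by (simp add: r')
    also have "\<dots> = C ((s # a) @ b)"
    proof -
      have "r' @ u \<in> lists V" "a @ b \<in> lists V" using s r'V unfolding ayb(1) by simp_all
      from C_cong[OF this ayb(2), of "[s]" "[]"] s(1) show ?thesis by simp
    qed
    finally have "C (r @ s # u) = C ((s # a) @ b)" .
    moreover have "s # u = (s # a) @ y # b" using ayb(1) by simp
    ultimately show ?thesis by blast
  qed
qed simp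

definition odd_refl :: "'v word set \<Rightarrow> 'v list \<Rightarrow> bool"
  where "odd_refl x u = odd (length (filter (\<lambda>r. C r = x) (refls u)))"

text \<open>As \<open>(st)\<^sup>m = 1\<close>, a prefix of odd length of \<open>stst\<dots>\<close> with \<open>2m\<close> letters is inverse to
  the remaining suffix; the suffix is a palindrome, hence an involution, and an odd prefix of
  \<open>tsts\<dots>\<close>.\<close>

lemma braid_reflections:
  assumes st: "{s, t} \<in> edges \<Delta>"
  shows "map C (refls (alternating t s (m s t))) = rev (map C (refls (alternating s t (m s t))))"
proof (rule nth_equalityI)
  fix i assume "i < length (map C (refls (alternating t s (m s t))))"
  then have i: "i < m s t" by (simp add: refls_alternating)
  define j where "j = m s t - 1 - i"
  note V = edgeD[OF st]
  note V' = alternating_in[OF V(1,2)] alternating_in[OF V(2,1)]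
  have "C (alternating s t (m s t + m s t)) = C (alternating s t (m s t) @ rev (alternating t s (m s t)))"
    by (subst alternating_add) (simp add: rev_alternating)
  also have "\<dots> = \<one>\<^bsub>W\<^esub>"
    using V' C_closed by (simp add: C_append C_rev braid_relation_cong[OF st])
  also have "m s t + m s t = (2 * j + 1) + (2 * i + 1)" using i by (simp add: j_def)
  finally have "C (alternating s t ((2 * j + 1) + (2 * i + 1))) = \<one>\<^bsub>W\<^esub>" .
  then have "C (alternating s t (2 * j + 1)) \<otimes>\<^bsub>W\<^esub> C (alternating t s (2 * i + 1)) = \<one>\<^bsub>W\<^esub>"
    using V' by (subst (asm) alternating_add) (simp add: C_append del: alternating.simps)
  then have "C (alternating s t (2 * j + 1)) = inv\<^bsub>W\<^esub> C (alternating t s (2 * i + 1))"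
    using V' C_closed by (intro W.inv_equality[symmetric]) blast+
  also have "\<dots> = C (alternating t s (2 * i + 1))"
    using C_rev[OF V'(2), of "2 * i + 1"] by (simp add: rev_alternating del: alternating.simps)
  finally show "map C (refls (alternating t s (m s t))) ! i =
      rev (map C (refls (alternating s t (m s t)))) ! i"
    using i by (simp add: refls_alternating rev_nth j_def del: alternating.simps)
qed (simp add: refls_alternating)

text \<open>Replacing a factor \<open>u\<close> of a word by \<open>v\<close>, where \<open>u = v\<close> in \<open>W\<close>, does not affect the
  reflections that come from the other letters. Those that come from the factor are conjugates of
  the reflections of \<open>u\<close> and \<open>v\<close>: they cancel in pairs for \<open>ss = 1\<close>, and are reordered by a
  braid relation.\<close>

lemma odd_refl_cong:
  assumes "u \<in> lists V" "C u = C v"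
  shows "odd_refl x u = odd_refl x v"
proof -
  let ?N = "\<lambda>a u. length (filter (\<lambda>g. C a \<otimes>\<^bsub>W\<^esub> g \<otimes>\<^bsub>W\<^esub> C (rev a) = x) (map C (refls u)))"
  have conj: "filter (\<lambda>r. C (a @ r @ rev a) = x) (refls u)
      = filter (\<lambda>r. C a \<otimes>\<^bsub>W\<^esub> C r \<otimes>\<^bsub>W\<^esub> C (rev a) = x) (refls u)"
    if "a \<in> lists V" "u \<in> lists V" for a u
    using that refls_in[OF that(2)] C_closed
    by (intro filter_cong) (auto simp: C_append W.m_assoc)
  have split: "odd_refl x (a @ u @ b) \<longleftrightarrow> odd (?N [] a + ?N a u + ?N (a @ u) b)"
    if "a \<in> lists V" "u \<in> lists V" "b \<in> lists V" for a u b
  proof -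
    have "a @ u \<in> lists V" using that by simp
    moreover have "filter (\<lambda>r. C r = x) (refls a) = filter (\<lambda>r. C ([] @ r @ rev []) = x) (refls a)"
      by simp
    ultimately show ?thesis
      unfolding odd_refl_def using that conj[of "[]" a] conj[of a u] conj[of "a @ u" b]
      by (simp add: refls_append filter_map comp_def) blast
  qed
  have step: "odd_refl x (a @ u @ b) = odd_refl x (a @ v @ b)"
    if "a \<in> lists V" "u \<in> lists V" "v \<in> lists V" "b \<in> lists V" "C u = C v"
      "even (?N a u) = even (?N a v)" for a u v b
  proof -
    have "C (a @ u) = C (a @ v)" "C (rev (a @ u)) = C (rev (a @ v))"
      using that C_append C_rev[of "a @ u"] C_rev[of "a @ v"] by simp_all
    then have "?N (a @ u) b = ?N (a @ v) b" by (simp only:)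
    with that show ?thesis by (simp only: split) presburger
  qed
  show ?thesis
  proof (rule coxeter_invariant[where F = "odd_refl x", OF _ _ assms])
    fix a b s assume "a \<in> lists V" "b \<in> lists V" "s \<in> V"
    then show "odd_refl x (a @ [s, s] @ b) = odd_refl x (a @ b)"
      using step[of a "[s, s]" "[]" b] C_delete_square[of s "[s]" "[]"] by (simp add: C_square C_Nil)
  next
    fix a b s t assume ab: "a \<in> lists V" "b \<in> lists V" and st: "{s, t} \<in> edges \<Delta>"
    have "?N a (alternating s t (m s t)) = ?N a (alternating t s (m s t))"
      by (simp only: braid_reflections[OF st] rev_filter[symmetric] length_rev)
    then show "odd_refl x (a @ alternating s t (m s t) @ b) = odd_refl x (a @ alternating t s (m s t) @ b)"
      using step[OF ab(1) alternating_in alternating_in ab(2) braid_relation_cong(1)[OF st]] edgeD[OF st]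
      by simp
  qed
qed

text \<open>If \<open>s\<close> is among the reflections of \<open>u\<close>, a letter of \<open>u\<close> can be deleted. Otherwise the
  multiplicity of \<open>s\<close> is odd for \<open>su\<close>, so \<open>s\<close> is also among the reflections of a reduced word
  \<open>v\<close> of \<open>su\<close>; then \<open>u = sv\<close> has a word shorter than \<open>v\<close>, which is impossible as \<open>v\<close> is at
  most as long as the reduced word \<open>u\<close>.\<close>

lemma exchange:
  assumes red: "reduced u" and s: "s \<in> V" and nred: "\<not> reduced (s # u)"
  shows "\<exists>a y b. u = a @ y # b \<and> C (s # u) = C (a @ b)"
proof -
  note u = reducedD(1)[OF red]
  have delete: "\<exists>a y b. v = a @ y # b \<and> C (s # v) = C (a @ b)"
    if "odd_refl (C [s]) v" "v \<in> lists V" for v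
  proof -
    from that(1) have "filter (\<lambda>r. C r = C [s]) (refls v) \<noteq> []"
      unfolding odd_refl_def by (metis even_zero list.size(3))
    then obtain r where r: "r \<in> set (refls v)" "C r = C [s]" by (auto simp: filter_empty_conv)
    then have "C (s # v) = C (r @ v)"
      using C_cong[of r "[s]" "[]" v] refls_in[OF that(2)] that(2) s by auto
    with refls_delete[OF that(2) r(1)] show ?thesis by simp
  qed
  obtain v where v: "reduced v" "C v = C (s # u)" using reduced_exists[of "s # u"] u s by auto
  note vV = reducedD(1)[OF v(1)]
  have len: "length v \<le> length u"
    using nred reduced_same_length[OF v(1), of "s # u"] v(2) u s by fastforce
  have odd_Cons: "odd_refl (C [s]) (s # u) \<longleftrightarrow> \<not> odd_refl (C [s]) u"
  proof -
    \<comment> \<open>conjugation by \<open>s\<close> fixes the reflection \<open>s\<close>\<close>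
    have "C (s # r @ [s]) = C [s] \<longleftrightarrow> C r = C [s]" if "r \<in> lists V" for r
    proof
      assume "C (s # r @ [s]) = C [s]"
      then show "C r = C [s]"
        using C_cancel_right[of "s # r" "[]" "[s]"] C_move_left[of s r "[]"] that s by simp
    next
      assume "C r = C [s]"
      then show "C (s # r @ [s]) = C [s]"
        using C_cong[of r "[s]" "[s]" "[s]"] C_delete_square[of s "[s]" "[]"] that s by simp
    qed
    then have "filter (\<lambda>r. C (s # r @ [s]) = C [s]) (refls u) = filter (\<lambda>r. C r = C [s]) (refls u)"
      using refls_in[OF u] by (intro filter_cong) auto
    then show ?thesis by (simp add: odd_refl_def filter_map comp_def)
  qed
  show ?thesis
  proof (cases "odd_refl (C [s]) u")
    case True
    then show ?thesis using delete u by blast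
  next
    case False
    then have "odd_refl (C [s]) v" using odd_refl_cong[OF vV v(2)] odd_Cons by simp
    then obtain a y b where ayb: "v = a @ y # b" "C (s # v) = C (a @ b)" using delete vV by blast
    have "C u = C (a @ b)" using C_move_left[of s u v] ayb v u s vV by simp
    then have "length u \<le> length (a @ b)" using vV ayb by (intro reducedD(2)[OF red]) auto
    with len ayb(1) show ?thesis by simp
  qed
qed

end

section \<open>The contragredient geometric representation\<close>

text \<open>Reflecting alternately in \<open>e\<^sub>s\<close> and \<open>e\<^sub>t\<close> with \<open>\<langle>e\<^sub>s, e\<^sub>t\<rangle> = -k\<close>, the coordinate reflected
  last and the one reflected next are \<open>-d\<^sub>n\<close> and \<open>d\<^sub>n\<^sub>+\<^sub>1\<close> for the sequence \<open>d\<close> below, which for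
  \<open>k = cos \<theta>\<close> is a Chebyshev recursion.\<close>

fun dihedral_seq :: "real \<Rightarrow> real \<Rightarrow> real \<Rightarrow> nat \<Rightarrow> real" where
  "dihedral_seq k p q 0 = - q"
| "dihedral_seq k p q (Suc 0) = p"
| "dihedral_seq k p q (Suc (Suc n)) = 2 * k * dihedral_seq k p q (Suc n) - dihedral_seq k p q n"

lemma dihedral_seq_shift:
  "dihedral_seq k (q + 2 * k * p) (- p) n = dihedral_seq k p q (Suc n)"
proof (induction k p q n rule: dihedral_seq.induct)
  case (3 k p q n)
  then show ?case by (simp only: dihedral_seq.simps(3))
qed simp_all

lemma dihedral_seq_sin:
  "sin \<theta> * dihedral_seq (cos \<theta>) p q n = sin (real n * \<theta>) * p + sin ((real n - 1) * \<theta>) * q"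
proof (induction "cos \<theta>" p q n rule: dihedral_seq.induct)
  case (3 p q n)
  have rec: "sin ((a + 2) * \<theta>) = 2 * cos \<theta> * sin ((a + 1) * \<theta>) - sin (a * \<theta>)" for a
    using sin_add[of "(a + 1) * \<theta>" \<theta>] sin_diff[of "(a + 1) * \<theta>" \<theta>] by (simp add: algebra_simps)
  have r1: "sin (real (Suc (Suc n)) * \<theta>) = 2 * cos \<theta> * sin (real (Suc n) * \<theta>) - sin (real n * \<theta>)"
    using rec[of "real n"] by (simp add: algebra_simps)
  have r2: "sin ((real (Suc (Suc n)) - 1) * \<theta>)
      = 2 * cos \<theta> * sin ((real (Suc n) - 1) * \<theta>) - sin ((real n - 1) * \<theta>)"
    using rec[of "real n - 1"] by (simp add: algebra_simps)
  have "sin \<theta> * dihedral_seq (cos \<theta>) p q (Suc (Suc n)) =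
     2 * cos \<theta> * (sin \<theta> * dihedral_seq (cos \<theta>) p q (Suc n)) - sin \<theta> * dihedral_seq (cos \<theta>) p q n"
    by (simp add: algebra_simps)
  also have "\<dots> = sin (real (Suc (Suc n)) * \<theta>) * p + sin ((real (Suc (Suc n)) - 1) * \<theta>) * q"
    unfolding 3 r1 r2 by (simp add: algebra_simps)
  finally show ?case .
qed auto

lemma dihedral_seq_affine: "dihedral_seq 1 p q n = real n * p + (real n - 1) * q"
  by (induction "1::real" p q n rule: dihedral_seq.induct) (auto simp: algebra_simps)

context artin_system
begin

text \<open>The bilinear form on all of \<open>V\<close>. Where there is no edge, the value \<open>-1\<close> makes the
  rotation \<open>st\<close> parabolic, hence of infinite order.\<close>

definition coef :: "'v \<Rightarrow> 'v \<Rightarrow> real"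
  where "coef s t = (if s = t then 1 else if {s, t} \<in> edges \<Delta> then - cos (pi / m s t) else -1)"

text \<open>The contragredient action on functionals, each given by its values \<open>f u\<close> on the basis vectors
  \<open>e\<^sub>u\<close>. In contrast to the action on vectors, it needs no sums over the basis.\<close>

definition act :: "'v \<Rightarrow> ('v \<Rightarrow> real) \<Rightarrow> 'v \<Rightarrow> real"
  where "act s f = (\<lambda>u. f u - 2 * coef s u * f s)"

lemma coef_same [simp]: "coef s s = 1"
  by (simp add: coef_def)

lemma coef_commute: "coef s t = coef t s"
  by (simp add: coef_def insert_commute)

lemma act_square: "act s (act s f) = f"
  by (simp add: act_def)

lemma act_alternating:
  fixes f :: "'v \<Rightarrow> real"
  assumes "s \<noteq> t"
  defines "d \<equiv> dihedral_seq (- coef s t) (f s) (f t)"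
  shows "fold act (alternating s t n) f (if even n then s else t) = d (Suc n)"
    and "fold act (alternating s t n) f (if even n then t else s) = - d n"
proof -
  have "fold act (alternating s t n) f (if even n then s else t) =
      dihedral_seq (- coef s t) (f s) (f t) (Suc n) \<and>
    fold act (alternating s t n) f (if even n then t else s) =
      - dihedral_seq (- coef s t) (f s) (f t) n"
    using assms(1)
  proof (induction n arbitrary: s t f)
    case (Suc n)
    have "act s f s = - f s" "act s f t = f t + 2 * - coef s t * f s"
      by (simp_all add: act_def)
    moreover have "dihedral_seq (- coef s t) (f t + 2 * - coef s t * f s) (- f s) k =
        dihedral_seq (- coef s t) (f s) (f t) (Suc k)" for k
      by (rule dihedral_seq_shift)
    ultimately show ?case
      using Suc.IH[of t s "act s f"] Suc.prems by (simp only: coef_commute[of t s]) auto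
  qed simp
  then show "fold act (alternating s t n) f (if even n then s else t) = d (Suc n)"
    and "fold act (alternating s t n) f (if even n then t else s) = - d n"
    by (simp_all add: d_def del: dihedral_seq.simps)
qed

lemma act_rank_two:
  "\<exists>a b. \<forall>u. fold act (alternating s t n) f u = f u - a * coef s u - b * coef t u"
proof (induction n arbitrary: s t f)
  case 0
  then show ?case by (auto intro!: exI[of _ 0])
next
  case (Suc n)
  from Suc[of t s "act s f"] obtain a b where
    ab: "fold act (alternating t s n) (act s f) u = act s f u - a * coef t u - b * coef s u" for u
    by blast
  have "fold act (alternating s t (Suc n)) f u = f u - (b + 2 * f s) * coef s u - a * coef t u" for u
    using ab[of u] by (simp add: act_def[of s f] algebra_simps)
  then show ?case by blast
qed

text \<open>On the two coordinates \<open>s\<close> and \<open>t\<close> both words have the same effect, since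
  \<open>sin(m\<theta>) = 0\<close> for \<open>\<theta> = \<pi>/m\<close>. The change in all other coordinates depends on two numbers only,
  which can be recovered from the change at \<open>s\<close> and \<open>t\<close>.\<close>

lemma act_braid:
  assumes st: "{s, t} \<in> edges \<Delta>"
  shows "fold act (alternating s t (m s t)) f = fold act (alternating t s (m s t)) f"
proof -
  define n where "n = m s t"
  define \<theta> where "\<theta> = pi / n"
  have ne: "s \<noteq> t" and n2: "2 \<le> n" using edgeD[OF st] by (simp_all add: n_def)
  have c: "coef s t = - cos \<theta>" "coef t s = - cos \<theta>"
    using st ne by (simp_all add: coef_def \<theta>_def n_def insert_commute)
  have \<theta>: "0 < \<theta>" "\<theta> < pi" using n2 by (simp_all add: \<theta>_def field_simps)
  then have sin: "sin \<theta> > 0" by (rule sin_gt_zero)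
  have n\<theta>: "real n * \<theta> = pi" using n2 by (simp add: \<theta>_def)
  have s1: "sin (real (Suc n) * \<theta>) = - sin \<theta>" "sin ((real n - 1) * \<theta>) = sin \<theta>"
    using n\<theta> by (simp_all add: algebra_simps sin_add sin_diff)
  have d: "dihedral_seq (cos \<theta>) p q n = q" "dihedral_seq (cos \<theta>) p q (Suc n) = - p" for p q
    using dihedral_seq_sin[of \<theta> p q n] dihedral_seq_sin[of \<theta> p q "Suc n"] sin n\<theta> s1
    by (simp_all del: dihedral_seq.simps of_nat_Suc) (simp_all add: mult_minus_right[symmetric] del: mult_minus_right)
  let ?g = "fold act (alternating s t n) f" and ?h = "fold act (alternating t s n) f"
  have eq: "?g s = ?h s" "?g t = ?h t"
    using act_alternating[OF ne, of n f] act_alternating[OF ne[symmetric], of n f]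
    by (simp_all add: c d split: if_splits)
  obtain a b where g: "\<And>u. ?g u = f u - a * coef s u - b * coef t u" using act_rank_two[of s t n f] by blast
  obtain a' b' where h: "\<And>u. ?h u = f u - a' * coef t u - b' * coef s u" using act_rank_two[of t s n f] by blast
  \<comment> \<open>the form is nondegenerate on the plane of \<open>e\<^sub>s\<close> and \<open>e\<^sub>t\<close>, as \<open>\<bar>cos \<theta>\<bar> < 1\<close>\<close>
  have e1: "a - b' = (b - a') * cos \<theta>" and e2: "b - a' = (a - b') * cos \<theta>"
    using eq g[of s] g[of t] h[of s] h[of t] by (simp_all add: c algebra_simps)
  have "(a - b') * (1 - (cos \<theta>)\<^sup>2) = 0"
    using e1 e2 by (simp add: algebra_simps power2_eq_square)
  then have "(a - b') * (sin \<theta>)\<^sup>2 = 0" by (simp add: sin_squared_eq)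
  with sin have "a = b'" by simp
  with e2 have "b = a'" by simp
  with \<open>a = b'\<close> g h show ?thesis by (intro ext) (simp add: n_def)
qed

lemma act_cong:
  assumes "u \<in> lists V" "C u = C v"
  shows "fold act u f = fold act v f"
proof -
  have "fold act u = fold act v"
  proof (rule coxeter_invariant[where F = "fold act", OF _ _ assms])
    fix a b s t assume st: "{s, t} \<in> edges \<Delta>"
    show "fold act (a @ alternating s t (m s t) @ b) = fold act (a @ alternating t s (m s t) @ b)"
      using act_braid[OF st] by (intro ext) (simp only: fold_append comp_apply)
  qed (intro ext, simp add: act_square)
  then show ?thesis by simp
qed

text \<open>Applied to the indicator of \<open>s\<close>, the two words give the opposite values \<open>-d\<^sub>n\<close> and
  \<open>d\<^sub>n\<close> at the coordinate in which the first one reflects last, so \<open>d\<^sub>n = 0\<close>. Now \<open>d\<^sub>n\<close> is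
  \<open>n\<close> if there is no edge, and \<open>sin(n\<theta>)/sin \<theta>\<close> with \<open>\<theta> = \<pi>/m\<close> if there is one, which is
  positive for \<open>0 < n < m\<close>.\<close>

lemma dihedral_order:
  assumes "s \<in> V" "t \<in> V" "s \<noteq> t" "0 < n"
    and eq: "C (alternating s t n) = C (alternating t s n)"
  shows "{s, t} \<in> edges \<Delta> \<and> m s t \<le> n"
proof -
  define f :: "'v \<Rightarrow> real" where "f = (\<lambda>u. if u = s then 1 else 0)"
  let ?d = "dihedral_seq (- coef s t) 1 0"
  have shift: "dihedral_seq (- coef s t) 0 1 (Suc n) = ?d n"
  proof -
    have "dihedral_seq k 0 1 (Suc n) = dihedral_seq k 1 0 n" for k
      by (induction k "1::real" "0::real" n rule: dihedral_seq.induct) auto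
    then show ?thesis .
  qed
  have "fold act (alternating s t n) f = fold act (alternating t s n) f"
    using assms by (intro act_cong alternating_in) auto
  then have "?d n = 0"
    using act_alternating(2)[OF assms(3), of n f] act_alternating(1)[OF assms(3)[symmetric], of n f]
      shift assms(3) coef_commute[of s t]
    by (simp add: f_def del: dihedral_seq.simps split: if_splits)
  show ?thesis
  proof (cases "{s, t} \<in> edges \<Delta>")
    case True
    define \<theta> where "\<theta> = pi / m s t"
    have "coef s t = - cos \<theta>" using True assms by (simp add: coef_def \<theta>_def)
    with \<open>?d n = 0\<close> have "sin (real n * \<theta>) = 0"
      using dihedral_seq_sin[of \<theta> 1 0 n] by simp
    moreover have "sin (real n * \<theta>) > 0" if "n < m s t"
      using that assms(4) by (intro sin_gt_zero) (simp_all add: \<theta>_def field_simps)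
    ultimately show ?thesis using True by (metis less_irrefl not_le)
  next
    case False
    then show ?thesis
      using \<open>?d n = 0\<close> assms dihedral_seq_affine[of 1 0 n] by (simp add: coef_def)
  qed
qed

section \<open>Matsumoto's theorem\<close>

text \<open>A braid relation turns \<open>s \<cdot> tst\<dots>\<close> into \<open>s \<cdot> sts\<dots>\<close>.\<close>

lemma alternating_not_reduced:
  assumes st: "{s, t} \<in> edges \<Delta>" and n: "m s t < n"
  shows "\<not> reduced (alternating s t n @ v)"
proof
  assume red: "reduced (alternating s t n @ v)"
  obtain j where j: "n = Suc (m s t) + j" using n less_imp_Suc_add by fastforce
  note V = edgeD[OF st]
  have "reduced (alternating s t (Suc (m s t)))"
    using reduced_infix[of "[]" "alternating s t (Suc (m s t))"] red
    unfolding j alternating_add by simp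
  moreover obtain k where k: "m s t = Suc k" using V(4) by (cases "m s t") auto
  have "C (alternating s t (Suc (m s t))) = C (alternating t s k)"
    using C_cong[of "alternating t s (m s t)" "alternating s t (m s t)" "[s]" "[]"]
      braid_relation_cong(1)[OF st] C_delete_square[of s "[]" "alternating t s k"] V alternating_in
    by (simp add: k)
  ultimately have "length (alternating s t (Suc (m s t))) \<le> length (alternating t s k)"
    using V alternating_in by (intro reducedD(2)) auto
  then show False using k by simp
qed

lemma letters_distinct:
  assumes "s \<in> V" "t \<in> V" "C [s] = C [t]" shows "s = t"
proof (rule ccontr)
  assume "s \<noteq> t"
  with dihedral_order[of s t 1] assms have "{s, t} \<in> edges \<Delta>" "m s t \<le> 1" by simp_all
  then show False using edgeD(4)[of s t] by simp
qed

text \<open>The exchange condition for the left descent \<open>t\<close> deletes a letter. If it lies in \<open>v\<close>, moving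
  \<open>t\<close> to the other side gives a longer alternating prefix. If it lies in the alternating word, it
  must be the last one: deleting the first would identify \<open>s\<close> and \<open>t\<close>, and deleting one
  in between makes two equal letters adjacent and the word too short.\<close>

lemma extend_alternating:
  assumes st: "s \<in> V" "t \<in> V" "s \<noteq> t" and n: "0 < n"
    and red: "reduced (alternating s t n @ v)" and nred: "\<not> reduced (t # alternating s t n @ v)"
  shows "C (alternating s t n) = C (alternating t s n) \<or>
    (\<exists>v'. reduced (alternating t s (Suc n) @ v') \<and>
      C (alternating t s (Suc n) @ v') = C (alternating s t n @ v))"
proof -
  let ?a = "alternating s t n"
  note aV = alternating_in[OF st(1,2), of n]
  have vV: "v \<in> lists V" using reducedD(1)[OF red] by simp
  obtain xs y ys where xy: "?a @ v = xs @ y # ys" "C (t # ?a @ v) = C (xs @ ys)"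
    using exchange[OF red st(2) nred] by blast
  have "xs @ y # ys \<in> lists V" using aV vV by (simp flip: xy(1))
  then have xyV: "xs \<in> lists V" "y \<in> V" "ys \<in> lists V" by simp_all
  consider xs' where "xs = ?a @ xs'" "v = xs' @ y # ys"
    | as where "?a = xs @ y # as" "ys = as @ v"
    using xy(1) by (auto simp: append_eq_append_conv2 append_eq_Cons_conv Cons_eq_append_conv)
  then show ?thesis
  proof cases
    case 1
    then have "C (alternating t s (Suc n) @ xs' @ ys) = C (?a @ v)"
      using C_move_left[of t "?a @ v" "?a @ xs' @ ys"] xy(2) st aV vV xyV by simp
    moreover from this have "reduced (alternating t s (Suc n) @ xs' @ ys)"
      using st aV vV xyV 1 by (intro reduced_same_length[OF red]) auto
    ultimately show ?thesis by blast
  next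
    case 2
    have asV: "as \<in> lists V" using 2(2) xyV by simp
    have "C (t # ?a) = C (xs @ as)"
      using C_cancel_right[of "t # ?a" "xs @ as" v] xy(2) 2 st aV vV xyV asV by simp
    then have a: "C ?a = C (t # xs @ as)"
      using C_move_left[of t ?a "xs @ as"] st aV xyV asV by simp
    have reda: "reduced ?a" using reduced_infix[of "[]" ?a v] red by simp
    obtain k where k: "n = Suc k" using n by (cases n) auto
    consider "xs = []" | "as = []" | xs' z z' as' where "xs = xs' @ [z]" "as = z' # as'"
      by (metis list.exhaust rev_exhaust)
    then show ?thesis
    proof cases
      case 1
      then have "?a = s # as" using 2(1) k by auto
      then have "C [s] = C [t]"
        using a 1 C_cancel_right[of "[s]" "[t]" as] st asV by simp
      then show ?thesis using letters_distinct st by blast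
    next
      case last: 2
      then have "xs = alternating s t k"
        using 2(1) alternating_Suc_right[of s t k] k by simp
      then show ?thesis using a last k by simp
    next
      case 3
      then have "z = z'" using 2(1) alternating_neighbours[of s t n xs' z y z' as'] by simp
      then have "C ?a = C (t # xs' @ as')"
        using a 3 C_delete_square[of z "t # xs'" as'] st xyV asV by simp
      then have "length ?a \<le> length (t # xs' @ as')"
        using 3 st xyV asV by (intro reducedD(2)[OF reda]) auto
      with 2(1) 3 show ?thesis by simp
    qed
  qed
qed

text \<open>Among all reduced words of the element that begin with an alternating word in \<open>s\<close> and
  \<open>t\<close>, one with the longest such prefix cannot be extended; so its prefix satisfies a braid
  relation, which forces the prefix to have length \<open>m\<^sub>s\<^sub>t\<close>.\<close>

lemma two_left_descents:
  assumes s: "reduced (s # u)" and t: "reduced (t # v)" and ne: "s \<noteq> t" and eq: "C (s # u) = C (t # v)"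
  shows "{s, t} \<in> edges \<Delta> \<and> (\<exists>x. reduced (alternating s t (m s t) @ x) \<and>
    C (alternating s t (m s t) @ x) = C (s # u))"
proof -
  let ?P = "\<lambda>n. \<exists>p q x. {p, q} = {s, t} \<and> reduced (alternating p q n @ x) \<and>
    C (alternating p q n @ x) = C (s # u)"
  have V: "s \<in> V" "t \<in> V" "u \<in> lists V" "v \<in> lists V"
    using reducedD(1)[OF s] reducedD(1)[OF t] by simp_all
  have P1: "?P 1" using s by (intro exI[of _ s] exI[of _ t] exI[of _ u]) simp
  have bound: "n \<le> length (s # u)" if "?P n" for n
  proof -
    from that obtain p q x where "reduced (alternating p q n @ x)" "C (alternating p q n @ x) = C (s # u)"
      by blast
    then show ?thesis using reducedD(2)[of _ "s # u"] V by fastforce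
  qed
  define n where "n = (GREATEST n. ?P n)"
  have Pn: "?P n" unfolding n_def using GreatestI_nat[of ?P] P1 bound by blast
  have max: "k \<le> n" if "?P k" for k unfolding n_def using Greatest_le_nat[of ?P] that bound by blast
  have n: "0 < n" using max[OF P1] by simp
  from Pn obtain p q x where pq: "{p, q} = {s, t}" and red: "reduced (alternating p q n @ x)"
    and C: "C (alternating p q n @ x) = C (s # u)" by blast
  from pq ne V have pq': "p \<in> V" "q \<in> V" "p \<noteq> q" by (auto simp: doubleton_eq_iff)
  note aV = alternating_in[OF pq'(1,2)] alternating_in[OF pq'(2,1)]
  have xV: "x \<in> lists V" using reducedD(1)[OF red] by simp
  \<comment> \<open>\<open>q\<close> is a left descent as well\<close>
  have "\<not> reduced (q # alternating p q n @ x)"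
  proof
    assume r: "reduced (q # alternating p q n @ x)"
    obtain w where w: "reduced (q # w)" "C (q # w) = C (s # u)"
      using pq s t eq by (auto simp: doubleton_eq_iff)
    have wV: "w \<in> lists V" using reducedD(1)[OF w(1)] by simp
    have "C (q # alternating p q n @ x) = C w"
      using C_move_left[of q w "alternating p q n @ x"] w C pq' wV aV xV by simp
    then have "length (q # alternating p q n @ x) \<le> length w"
      using reducedD(2)[OF r wV] by simp
    moreover have "length (q # w) \<le> length (alternating p q n @ x)"
      using aV xV w C by (intro reducedD(2)[OF w(1)]) auto
    ultimately show False by simp
  qed
  from extend_alternating[OF pq' n red this] max[of "Suc n"] pq C
  have swap: "C (alternating p q n) = C (alternating q p n)"
    by (metis Suc_n_not_le_n insert_commute)
  from dihedral_order[OF pq' n swap] have edge: "{p, q} \<in> edges \<Delta>" and "m p q \<le> n" by simp_all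
  moreover have "n \<le> m p q" using alternating_not_reduced[OF edge, of n x] red by (meson not_le)
  ultimately have nm: "n = m s t" using pq by simp
  have C': "C (alternating q p n @ x) = C (s # u)"
    using C_cong[of "alternating q p n" "alternating p q n" "[]" x] aV xV swap C by simp
  have red': "reduced (alternating q p n @ x)"
    using C' C aV xV by (intro reduced_same_length[OF red]) auto
  from pq consider "p = s" "q = t" | "p = t" "q = s" by (auto simp: doubleton_eq_iff)
  then show ?thesis
    using edge pq red red' C C' unfolding nm[symmetric] by cases auto
qed

text \<open>Words with the same first letter are compared by induction. Otherwise both are compared with
  words that begin with the two sides of the braid relation between their first letters.\<close>

theorem matsumoto:
  assumes "reduced u" "reduced v" "C u = C v"
  shows "A u = A v"
  using assms
proof (induction "length u" arbitrary: u v rule: less_induct)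
  case less
  have len: "length u = length v"
    using reducedD(2)[OF less(2), of v] reducedD(2)[OF less(3), of u] reducedD(1)[OF less(2)]
      reducedD(1)[OF less(3)] less(4) by (intro antisym) simp_all
  \<comment> \<open>a common first letter is cancelled\<close>
  have head: "A (s # x) = A (s # y)"
    if "reduced (s # x)" "reduced (s # y)" "C (s # x) = C (s # y)" "length (s # x) = length u" for s x y
  proof -
    have V: "s \<in> V" "x \<in> lists V" "y \<in> lists V"
      using reducedD(1)[OF that(1)] reducedD(1)[OF that(2)] by simp_all
    have "C x = C y" using that(3) C_cancel_left[of x y "[s]"] V by simp
    moreover have "reduced x" "reduced y"
      using that(1,2) reduced_infix[of "[s]" x "[]"] reduced_infix[of "[s]" y "[]"] by simp_all
    moreover have "length x < length u" using that(4) by simp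
    ultimately have "A x = A y" using less(1)[of x y] by blast
    then show ?thesis using A_append[of "[s]" x] A_append[of "[s]" y] V by simp
  qed
  show ?case
  proof (cases u)
    case Nil
    then show ?thesis using len by simp
  next
    case u: (Cons s u')
    then obtain t v' where v: "v = t # v'" using len by (cases v) auto
    show ?thesis
    proof (cases "s = t")
      case True
      then show ?thesis using head[of s u' v'] less(2-4) u v by simp
    next
      case False
      obtain x where st: "{s, t} \<in> edges \<Delta>" and red: "reduced (alternating s t (m s t) @ x)"
        and C: "C (alternating s t (m s t) @ x) = C u"
        using two_left_descents[OF _ _ False] less(2-4) unfolding u v by metis
      note V = edgeD[OF st] alternating_in[OF edgeD(1,2)[OF st]] alternating_in[OF edgeD(2,1)[OF st]]
      have xV: "x \<in> lists V" using reducedD(1)[OF red] by simp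
      obtain k where k: "m s t = Suc k" using V(4) by (cases "m s t") auto
      have C': "C (alternating t s (m s t) @ x) = C v"
        using C less(4) V xV braid_relation_cong(1)[OF st] by (simp add: C_append)
      have l: "length (alternating s t (m s t) @ x) = length u"
        using reducedD(2)[OF red, of u] reducedD(2)[OF less(2), of "alternating s t (m s t) @ x"]
          reducedD(1)[OF less(2)] C V xV by (intro antisym) simp_all
      have red': "reduced (alternating t s (m s t) @ x)"
        using C C' less(4) V xV by (intro reduced_same_length[OF red]) auto
      have "A u = A (alternating s t (m s t) @ x)"
        using head[of s u' "alternating t s k @ x"] less(2) red C u k by simp
      also have "\<dots> = A (alternating t s (m s t) @ x)"
        using V xV braid_relation_cong(2)[OF st] by (simp add: A_append)
      also have "\<dots> = A v"
        using head[of t "alternating s t k @ x" v'] less(3) red' C' v k l by simp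
      finally show ?thesis .
    qed
  qed
qed

end

section \<open>Maps between coset complexes\<close>

lemma realisation_map_simplex:
  assumes fin: "finite \<C>" and p: "inj_on p \<C>" and q: "inj_on q \<C>"
    and f: "\<And>T. T \<in> \<C> \<Longrightarrow> f (p T) = q T" and y: "y \<in> simplex_points (p ` \<C>)"
  shows "T \<in> \<C> \<Longrightarrow> realisation_map f y (q T) = y (p T)"
    and "realisation_map f y \<in> simplex_points (q ` \<C>)"
proof -
  have supp: "c \<in> p ` \<C>" if "y c \<noteq> 0" for c using y that by (auto simp: simplex_points_def)
  show coord: "realisation_map f y (q T) = y (p T)" if T: "T \<in> \<C>" for T
  proof -
    have "{c. y c \<noteq> 0 \<and> f c = q T} = (if y (p T) = 0 then {} else {p T})"
      using supp f T inj_onD[OF q] by (auto simp: image_iff) metis+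
    then show ?thesis by (simp add: realisation_map_def)
  qed
  have out: "realisation_map f y d = 0" if "d \<notin> q ` \<C>" for d
  proof -
    have "{c. y c \<noteq> 0 \<and> f c = d} = {}" using supp f that by blast
    then show ?thesis by (simp only: realisation_map_def sum.empty)
  qed
  have nonneg: "0 \<le> y c" for c using y by (simp add: simplex_points_def)
  have "sum (realisation_map f y) (q ` \<C>) = (\<Sum>T\<in>\<C>. y (p T))"
    using coord by (simp add: sum.reindex[OF q])
  also have "\<dots> = 1" using y by (simp add: simplex_points_def sum.reindex[OF p])
  finally show "realisation_map f y \<in> simplex_points (q ` \<C>)"
    using out nonneg by (simp add: simplex_points_def realisation_map_def sum_nonneg)
qed

lemma moussong_simplex_dist_cong:
  assumes "\<And>T. T \<in> \<C> \<Longrightarrow> x T = x' T" "\<And>T. T \<in> \<C> \<Longrightarrow> y T = y' T"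
  shows "moussong_simplex_dist \<Delta> \<C> x y = moussong_simplex_dist \<Delta> \<C> x' y'"
  using assms by (simp add: moussong_simplex_dist_def)

locale coset_family = group H for H :: "('g, 'b) monoid_scheme" (structure) +
  fixes P :: "'v set \<Rightarrow> 'g set" and F :: "'v set set"
  assumes subgroup: "T \<in> F \<Longrightarrow> subgroup (P T) H"
    and subset_iff: "\<lbrakk>T \<in> F; R \<in> F\<rbrakk> \<Longrightarrow> P T \<subseteq> P R \<longleftrightarrow> T \<subseteq> R"
begin

text \<open>The coset of the larger subgroup may be represented by any element of the smaller coset, and
  inclusions between cosets with a common representative are inclusions between subgroups.\<close>

lemma coset_subset:
  assumes T: "T \<in> F" and R: "R \<in> F" and g: "g \<in> carrier H" and g': "g' \<in> carrier H"
    and sub: "g <# P T \<subseteq> g' <# P R"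
  shows "T \<subseteq> R" "g <# P R = g' <# P R"
proof -
  have "g \<in> g' <# P R" using sub lcos_self[OF g subgroup[OF T]] by blast
  then show eq: "g <# P R = g' <# P R"
    using l_repr_independence[OF _ g' subgroup[OF R]] by simp
  have "h \<in> P R" if h: "h \<in> P T" for h
  proof -
    have "g \<otimes> h \<in> g <# P R" using sub h unfolding eq by (auto simp: l_coset_def)
    then obtain k where "k \<in> P R" "g \<otimes> h = g \<otimes> k" by (auto simp: l_coset_def)
    moreover have "h \<in> carrier H" "k \<in> carrier H"
      using h \<open>k \<in> P R\<close> subgroup.mem_carrier[OF subgroup] T R by blast+
    ultimately show ?thesis using g Units_l_cancel[of g h k] Units_eq by simp
  qed
  then show "T \<subseteq> R" using subset_iff[OF T R] by blast
qed

lemma coset_inj: "g \<in> carrier H \<Longrightarrow> inj_on (\<lambda>T. g <# P T) F"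
  by (intro inj_onI subset_antisym; rule coset_subset(1)[of _ _ g g]) auto

lemma coset_mono: "P T \<subseteq> P R \<Longrightarrow> g <# P T \<subseteq> g <# P R"
  by (auto simp: l_coset_def)

text \<open>A representative of the least coset of a chain represents all of them.\<close>

lemma simplex_translateE:
  assumes "\<sigma> \<in> coset_simplices H P F"
  obtains g \<C> where "g \<in> carrier H" "finite \<C>" "\<C> \<noteq> {}" "subset.chain F \<C>"
    "\<sigma> = (\<lambda>T. g <# P T) ` \<C>"
proof -
  from assms have \<sigma>: "finite \<sigma>" "\<sigma> \<noteq> {}" "\<sigma> \<subseteq> coset_vertices H P F"
    and cmp: "\<And>c d. c \<in> \<sigma> \<Longrightarrow> d \<in> \<sigma> \<Longrightarrow> c \<subseteq> d \<or> d \<subseteq> c"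
    by (auto simp: coset_simplices_def subset_chain_def)
  obtain c where c: "c \<in> \<sigma>" "\<And>d. d \<in> \<sigma> \<Longrightarrow> c \<subseteq> d"
    using finite_has_minimal[OF \<sigma>(1,2)] cmp by metis
  with \<sigma>(3) obtain g T where g: "g \<in> carrier H" and T: "T \<in> F" "c = g <# P T"
    by (auto simp: coset_vertices_def)
  define \<C> where "\<C> = {R \<in> F. g <# P R \<in> \<sigma>}"
  have im: "\<sigma> = (\<lambda>T. g <# P T) ` \<C>"
  proof
    show "\<sigma> \<subseteq> (\<lambda>T. g <# P T) ` \<C>"
    proof
      fix d assume d: "d \<in> \<sigma>"
      then obtain g' R where R: "g' \<in> carrier H" "R \<in> F" "d = g' <# P R"
        using \<sigma>(3) by (auto simp: coset_vertices_def)
      with c(2)[OF d] T g have "d = g <# P R" using coset_subset(2) by metis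
      with d R(2) show "d \<in> (\<lambda>T. g <# P T) ` \<C>" by (auto simp: \<C>_def)
    qed
  qed (auto simp: \<C>_def)
  have sub: "\<C> \<subseteq> F" by (auto simp: \<C>_def)
  have "finite \<C>"
    using \<sigma>(1) unfolding im by (rule finite_imageD) (rule inj_on_subset[OF coset_inj[OF g] sub])
  moreover have "\<C> \<noteq> {}" using im \<sigma>(2) by auto
  moreover have "subset.chain F \<C>"
    unfolding subset_chain_def
  proof (intro conjI ballI sub)
    fix R S assume RS: "R \<in> \<C>" "S \<in> \<C>"
    then have "R \<in> F" "S \<in> F" "g <# P R \<subseteq> g <# P S \<or> g <# P S \<subseteq> g <# P R"
      using cmp by (auto simp: \<C>_def)
    then show "R \<subseteq> S \<or> S \<subseteq> R" using coset_subset(1)[OF _ _ g g] by blast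
  qed
  ultimately show thesis using that g im by blast
qed

lemma translate_simplex:
  assumes "g \<in> carrier H" "finite \<C>" "\<C> \<noteq> {}" "subset.chain F \<C>"
  shows "(\<lambda>T. g <# P T) ` \<C> \<in> coset_simplices H P F"
proof -
  have "g <# P T \<subseteq> g <# P R \<or> g <# P R \<subseteq> g <# P T" if "T \<in> \<C>" "R \<in> \<C>" for T R
  proof -
    have "T \<in> F" "R \<in> F" "T \<subseteq> R \<or> R \<subseteq> T" using assms(4) that by (auto simp: subset_chain_def)
    then show ?thesis using subset_iff coset_mono by metis
  qed
  then show ?thesis
    using assms by (auto simp: coset_simplices_def subset_chain_def coset_vertices_def)
qed

lemma realisationE:
  assumes "x \<in> realisation (coset_simplices H P F)"
  obtains g \<C> where "g \<in> carrier H" "finite \<C>" "\<C> \<noteq> {}" "subset.chain F \<C>"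
    "x \<in> simplex_points ((\<lambda>T. g <# P T) ` \<C>)"
proof -
  from assms obtain \<sigma> where "\<sigma> \<in> coset_simplices H P F" "x \<in> simplex_points \<sigma>"
    by (auto simp: realisation_def)
  with that show thesis by (metis simplex_translateE)
qed

end

text \<open>Because such a map of vertices keeps the type \<open>T\<close> and moves all vertices of a translate \<open>g\<C>\<close> by
  the same \<open>\<phi> g\<close>, it preserves barycentric coordinates and the length of strings.\<close>

locale coset_morphism =
  src: coset_family H P F + tgt: coset_family H' P' F
  for H :: "('g, 'b) monoid_scheme" and P :: "'v set \<Rightarrow> 'g set"
    and H' :: "('h, 'c) monoid_scheme" and P' :: "'v set \<Rightarrow> 'h set" and F :: "'v set set" +
  fixes f :: "'g set \<Rightarrow> 'h set" and \<phi> :: "'g \<Rightarrow> 'h"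
  assumes closed: "g \<in> carrier H \<Longrightarrow> \<phi> g \<in> carrier H'"
    and vertex: "\<lbrakk>g \<in> carrier H; T \<in> F\<rbrakk> \<Longrightarrow> f (g <#\<^bsub>H\<^esub> P T) = \<phi> g <#\<^bsub>H'\<^esub> P' T"
begin

lemma map_simplex:
  assumes g: "g \<in> carrier H" and \<C>: "finite \<C>" "subset.chain F \<C>"
    and y: "y \<in> simplex_points ((\<lambda>T. g <#\<^bsub>H\<^esub> P T) ` \<C>)"
  shows "T \<in> \<C> \<Longrightarrow> realisation_map f y (\<phi> g <#\<^bsub>H'\<^esub> P' T) = y (g <#\<^bsub>H\<^esub> P T)"
    and "realisation_map f y \<in> simplex_points ((\<lambda>T. \<phi> g <#\<^bsub>H'\<^esub> P' T) ` \<C>)"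
proof -
  have sub: "\<C> \<subseteq> F" using \<C>(2) by (simp add: subset_chain_def)
  note inj = inj_on_subset[OF src.coset_inj[OF g] sub] inj_on_subset[OF tgt.coset_inj[OF closed[OF g]] sub]
  have f: "f (g <#\<^bsub>H\<^esub> P T) = \<phi> g <#\<^bsub>H'\<^esub> P' T" if "T \<in> \<C>" for T
    using vertex g sub that by blast
  note * = realisation_map_simplex[of \<C> "\<lambda>T. g <#\<^bsub>H\<^esub> P T" "\<lambda>T. \<phi> g <#\<^bsub>H'\<^esub> P' T" f y, OF \<C>(1) inj f y]
  show "T \<in> \<C> \<Longrightarrow> realisation_map f y (\<phi> g <#\<^bsub>H'\<^esub> P' T) = y (g <#\<^bsub>H\<^esub> P T)" by (rule *(1))
  show "realisation_map f y \<in> simplex_points ((\<lambda>T. \<phi> g <#\<^bsub>H'\<^esub> P' T) ` \<C>)" by (rule *(2))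
qed

lemma map_realisation:
  assumes "x \<in> realisation (coset_simplices H P F)"
  shows "realisation_map f x \<in> realisation (coset_simplices H' P' F)"
proof -
  obtain g \<C> where *: "g \<in> carrier H" "finite \<C>" "\<C> \<noteq> {}" "subset.chain F \<C>"
    "x \<in> simplex_points ((\<lambda>T. g <#\<^bsub>H\<^esub> P T) ` \<C>)"
    using src.realisationE[OF assms] by blast
  then show ?thesis
    using map_simplex(2)[OF *(1,2,4,5)] tgt.translate_simplex[OF closed[OF *(1)] *(2-4)]
    by (auto simp: realisation_def)
qed

lemma map_string:
  assumes F: "F = spherical_subsets \<Delta>" and str: "moussong_string \<Delta> H P x y l"
  shows "moussong_string \<Delta> H' P' (realisation_map f x) (realisation_map f y) l"
  using str
proof (induction rule: moussong_string.induct)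
  case (start x)
  then show ?case using map_realisation by (intro moussong_string.start) (simp add: F)
next
  case (step x y l g \<C> z)
  then have \<C>: "subset.chain F \<C>" by (simp add: F)
  note y = map_simplex[OF step(2,3) \<C> step(6)] and z = map_simplex[OF step(2,3) \<C> step(7)]
  have "moussong_simplex_dist \<Delta> \<C> (\<lambda>T. y (g <#\<^bsub>H\<^esub> P T)) (\<lambda>T. z (g <#\<^bsub>H\<^esub> P T)) =
    moussong_simplex_dist \<Delta> \<C> (\<lambda>T. realisation_map f y (\<phi> g <#\<^bsub>H'\<^esub> P' T))
      (\<lambda>T. realisation_map f z (\<phi> g <#\<^bsub>H'\<^esub> P' T))"
    using y(1) z(1) by (intro moussong_simplex_dist_cong) simp_all
  then show ?case
    using moussong_string.step[OF step.IH closed[OF step(2)] step(3-5) y(2) z(2)] by simp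
qed

end

text \<open>By \<open>map_string\<close> in both directions, two points are joined by strings of the same lengths as
  their images, so the distances are infima of the same set.\<close>

theorem moussong_dist_retract:
  assumes i: "coset_morphism H P H' P' (spherical_subsets \<Delta>) i \<phi>"
    and r: "coset_morphism H' P' H P (spherical_subsets \<Delta>) r \<psi>"
    and left_inverse: "\<And>g. g \<in> carrier H \<Longrightarrow> \<psi> (\<phi> g) = g"
    and x: "x \<in> realisation (coset_simplices H P (spherical_subsets \<Delta>))"
    and y: "y \<in> realisation (coset_simplices H P (spherical_subsets \<Delta>))"
  shows "moussong_dist \<Delta> H' P' (realisation_map i x) (realisation_map i y) = moussong_dist \<Delta> H P x y"
proof -
  interpret i: coset_morphism H P H' P' "spherical_subsets \<Delta>" i \<phi> by (rule i)
  interpret r: coset_morphism H' P' H P "spherical_subsets \<Delta>" r \<psi> by (rule r)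
  have retract: "realisation_map r (realisation_map i x) = x"
    if "x \<in> realisation (coset_simplices H P (spherical_subsets \<Delta>))" for x
  proof
    fix c
    obtain g \<C> where g: "g \<in> carrier H" and \<C>: "finite \<C>" "\<C> \<noteq> {}" "subset.chain (spherical_subsets \<Delta>) \<C>"
      and x: "x \<in> simplex_points ((\<lambda>T. g <#\<^bsub>H\<^esub> P T) ` \<C>)"
      using i.src.realisationE[OF \<open>x \<in> _\<close>] by blast
    note ix = i.map_simplex[OF g \<C>(1,3) x]
    note rx = r.map_simplex[OF i.closed[OF g] \<C>(1,3) ix(2), unfolded left_inverse[OF g]]
    show "realisation_map r (realisation_map i x) c = x c"
    proof (cases "c \<in> (\<lambda>T. g <#\<^bsub>H\<^esub> P T) ` \<C>")
      case True
      then show ?thesis using ix(1) rx(1) by auto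
    next
      case False
      then show ?thesis using x rx(2) by (simp add: simplex_points_def)
    qed
  qed
  have "moussong_string \<Delta> H' P' (realisation_map i x) (realisation_map i y) l
      \<longleftrightarrow> moussong_string \<Delta> H P x y l" for l
    using i.map_string[OF HOL.refl, of x y l]
      r.map_string[OF HOL.refl, of "realisation_map i x" "realisation_map i y" l] retract x y by auto
  then show ?thesis by (simp add: moussong_dist_def)
qed

section \<open>Parabolic subgroups and the two maps of vertices\<close>

context artin_system
begin

lemma coxeter_parabolic_subgroup:
  assumes "T \<subseteq> V" shows "subgroup (coxeter_parabolic \<Delta> T) W"
  unfolding coxeter_parabolic_def using assms C_closed
  by (intro W.generate_is_subgroup) (auto simp del: in_lists_conv_set)

lemma artin_parabolic_subgroup:
  assumes "T \<subseteq> V" shows "subgroup (artin_parabolic \<Delta> T) G"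
  unfolding artin_parabolic_def using assms A_closed
  by (intro G.generate_is_subgroup) auto

lemma parabolic_words:
  assumes "x \<in> coxeter_parabolic \<Delta> T" "T \<subseteq> V"
  obtains u where "u \<in> lists T" "u \<in> lists V" "x = C u"
proof -
  have "\<exists>u\<in>lists T. x = C u" using assms(1) unfolding coxeter_parabolic_def
  proof (induction rule: generate.induct)
    case one
    then show ?case by (intro bexI[of _ "[]"]) (simp_all add: C_Nil)
  next
    case (incl h)
    then obtain s where "s \<in> T" "h = C [s]" by blast
    then show ?case by (intro bexI[of _ "[s]"]) simp_all
  next
    case (inv h)
    then obtain s where "s \<in> T" "h = C [s]" by blast
    then show ?case using C_rev[of "[s]"] assms(2) by (intro bexI[of _ "[s]"]) auto
  next
    case (eng h k)
    then obtain u v where "u \<in> lists T" "v \<in> lists T" "h = C u" "k = C v" by blast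
    then show ?case using assms(2) lists_mono[OF assms(2)]
      by (intro bexI[of _ "u @ v"]) (auto simp: C_append)
  qed
  with that lists_mono[OF assms(2)] show thesis by blast
qed

text \<open>The indicator of \<open>s\<close> is fixed by \<open>W\<^sub>T\<close> and moved by \<open>s\<close>.\<close>

lemma parabolic_letter:
  assumes "s \<in> V" "T \<subseteq> V" "C [s] \<in> coxeter_parabolic \<Delta> T"
  shows "s \<in> T"
proof (rule ccontr)
  assume s: "s \<notin> T"
  define f :: "'v \<Rightarrow> real" where "f = (\<lambda>u. if u = s then 1 else 0)"
  obtain u where u: "u \<in> lists T" "C [s] = C u" using parabolic_words assms by metis
  from u(1) have "fold act u f = f"
  proof (induction u)
    case (Cons t u)
    then have "act t f = f" using s by (auto simp: act_def f_def)
    with Cons show ?case by simp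
  qed simp
  moreover have "fold act [s] f = fold act u f" using u(2) assms(1) by (intro act_cong) simp_all
  ultimately have "act s f s = f s" by simp
  then show False by (simp add: act_def f_def)
qed

lemma coxeter_parabolic_subset_iff:
  assumes "T \<subseteq> V" "R \<subseteq> V"
  shows "coxeter_parabolic \<Delta> T \<subseteq> coxeter_parabolic \<Delta> R \<longleftrightarrow> T \<subseteq> R"
proof
  assume sub: "coxeter_parabolic \<Delta> T \<subseteq> coxeter_parabolic \<Delta> R"
  show "T \<subseteq> R"
  proof
    fix s assume "s \<in> T"
    then have "C [s] \<in> coxeter_parabolic \<Delta> T" by (auto simp: coxeter_parabolic_def intro: generate.incl)
    with sub assms \<open>s \<in> T\<close> show "s \<in> R" by (intro parabolic_letter[OF _ assms(2)]) auto
  qed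
next
  assume "T \<subseteq> R"
  then show "coxeter_parabolic \<Delta> T \<subseteq> coxeter_parabolic \<Delta> R"
    unfolding coxeter_parabolic_def by (intro W.mono_generate) auto
qed

text \<open>The canonical projection \<open>G \<rightarrow> W\<close>, which sends the class of a word to the class of the same
  word.\<close>

definition proj :: "'v word set \<Rightarrow> 'v word set"
  where "proj X = {w. \<exists>x\<in>X. cox x w}"

lemma artin_coxeter_word_eq: "word_eq V (artin_relations \<Delta>) u v \<Longrightarrow> cox u v"
proof (induction rule: word_eq.induct)
  case (relation a b u v)
  then show ?case by (intro word_eq.relation) (auto simp: coxeter_relations_def)
qed (blast intro: word_eq.intros)+

lemma proj_class:
  assumes "w \<in> words V"
  shows "proj (word_class V (artin_relations \<Delta>) w) = word_class V (coxeter_relations \<Delta>) w"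
proof -
  have "cox w u \<longleftrightarrow> (\<exists>x. word_eq V (artin_relations \<Delta>) w x \<and> cox x u)" for u
    using assms artin_coxeter_word_eq by (blast intro: word_eq.refl word_eq.trans)
  then show ?thesis by (simp add: proj_def word_class_def)
qed

lemma proj_A: "u \<in> lists V \<Longrightarrow> proj (A u) = C u"
  by (simp add: artin_elt_def coxeter_elt_def proj_class positive_word_in)

lemma proj_hom: "group_hom G W proj"
proof (intro group_hom.intro group_hom_axioms.intro homI)
  show "Group.group G" "Group.group W" by (rule group_G, rule group_W)
next
  fix x assume "x \<in> carrier G"
  then show "proj x \<in> carrier W"
    by (auto simp: artin_group_def coxeter_group_def presented_group_def proj_class)
next
  fix x y assume "x \<in> carrier G" "y \<in> carrier G"
  then obtain u v where "u \<in> words V" "v \<in> words V"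
    "x = word_class V (artin_relations \<Delta>) u" "y = word_class V (artin_relations \<Delta>) v"
    by (auto simp: artin_group_def presented_group_def)
  then show "proj (x \<otimes>\<^bsub>G\<^esub> y) = proj x \<otimes>\<^bsub>W\<^esub> proj y"
    by (simp add: artin_group_def coxeter_group_def presented_group_mult proj_class)
qed

lemma proj_parabolic:
  assumes "T \<subseteq> V" shows "proj ` artin_parabolic \<Delta> T = coxeter_parabolic \<Delta> T"
proof -
  have "(\<lambda>s. A [s]) ` T \<subseteq> carrier G" using assms A_closed by auto
  moreover have "proj ` (\<lambda>s. A [s]) ` T = (\<lambda>s. C [s]) ` T"
    using assms by (force simp: image_image proj_A intro!: image_cong)
  ultimately show ?thesis
    using group_hom.generate_img[OF proj_hom, of "(\<lambda>s. A [s]) ` T"]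
    by (simp add: artin_parabolic_def coxeter_parabolic_def)
qed

lemma artin_parabolic_subset_iff:
  assumes "T \<subseteq> V" "R \<subseteq> V"
  shows "artin_parabolic \<Delta> T \<subseteq> artin_parabolic \<Delta> R \<longleftrightarrow> T \<subseteq> R"
proof
  assume "artin_parabolic \<Delta> T \<subseteq> artin_parabolic \<Delta> R"
  then have "proj ` artin_parabolic \<Delta> T \<subseteq> proj ` artin_parabolic \<Delta> R" by (rule image_mono)
  then show "T \<subseteq> R" using assms by (simp add: proj_parabolic coxeter_parabolic_subset_iff)
next
  assume "T \<subseteq> R"
  then show "artin_parabolic \<Delta> T \<subseteq> artin_parabolic \<Delta> R"
    unfolding artin_parabolic_def by (intro G.mono_generate) auto
qed

lemma spherical_in: "T \<in> spherical_subsets \<Delta> \<Longrightarrow> T \<subseteq> V"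
  by (simp add: spherical_subsets_def)

lemma davis_family: "coset_family W (coxeter_parabolic \<Delta>) (spherical_subsets \<Delta>)"
  by (intro coset_family.intro coset_family_axioms.intro group_W)
    (simp_all add: spherical_in coxeter_parabolic_subgroup coxeter_parabolic_subset_iff)

lemma deligne_family: "coset_family G (artin_parabolic \<Delta>) (spherical_subsets \<Delta>)"
  by (intro coset_family.intro coset_family_axioms.intro group_G)
    (simp_all add: spherical_in artin_parabolic_subgroup artin_parabolic_subset_iff)

lemma projection_morphism:
  "coset_morphism G (artin_parabolic \<Delta>) W (coxeter_parabolic \<Delta>) (spherical_subsets \<Delta>) ((`) proj) proj"
proof -
  interpret group_hom G W proj by (rule proj_hom)
  have "proj ` (g <#\<^bsub>G\<^esub> artin_parabolic \<Delta> T) = proj g <#\<^bsub>W\<^esub> coxeter_parabolic \<Delta> T"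
    if "g \<in> carrier G" "T \<in> spherical_subsets \<Delta>" for g T
  proof -
    note T = spherical_in[OF that(2)]
    have "artin_parabolic \<Delta> T \<subseteq> carrier G" using artin_parabolic_subgroup[OF T] by (rule subgroup.subset)
    then show ?thesis
      using that(1) unfolding l_coset_def proj_parabolic[OF T, symmetric] by (force simp: image_iff)
  qed
  then show ?thesis
    by (intro coset_morphism.intro coset_morphism_axioms.intro davis_family deligne_family) simp_all
qed

text \<open>By Matsumoto's theorem, the choice of the reduced word is immaterial.\<close>

lemma tits_reduced:
  assumes "reduced u" shows "tits_section \<Delta> (C u) = A u"
proof -
  let ?v = "SOME v. reduced v \<and> C v = C u"
  have "reduced ?v \<and> C ?v = C u" using someI[of "\<lambda>v. reduced v \<and> C v = C u" u] assms by blast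
  then show ?thesis using matsumoto[of ?v u] assms by (simp add: tits_section_def)
qed

lemma carrier_reducedE:
  assumes "w \<in> carrier W" obtains u where "reduced u" "w = C u"
  using assms reduced_exists unfolding carrier_W by (metis imageE)

lemma tits_closed: "w \<in> carrier W \<Longrightarrow> tits_section \<Delta> w \<in> carrier G"
  by (metis carrier_reducedE tits_reduced A_closed reducedD(1))

lemma proj_tits: "w \<in> carrier W \<Longrightarrow> proj (tits_section \<Delta> w) = w"
  by (metis carrier_reducedE tits_reduced proj_A reducedD(1))

text \<open>The exchange condition for the reversed word; the deleted letter is replaced by a last letter
  \<open>s\<close>.\<close>

lemma reduced_ending:
  assumes red: "reduced u" and s: "s \<in> V" and nred: "\<not> reduced (u @ [s])"
  obtains v where "reduced (v @ [s])" "C (v @ [s]) = C u"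
proof -
  note u = reducedD(1)[OF red]
  have "\<not> reduced (s # rev u)" using reduced_rev[of "s # rev u"] nred by auto
  then obtain a y b where ayb: "rev u = a @ y # b" "C (s # rev u) = C (a @ b)"
    using exchange[OF reduced_rev[OF red] s] by blast
  have "a @ y # b \<in> lists V" using u by (simp flip: ayb(1))
  then have V: "a \<in> lists V" "b \<in> lists V" by simp_all
  have "C (rev u) = C (s # a @ b)" using C_move_left[of s "rev u" "a @ b"] s u V ayb(2) by simp
  then have "inv\<^bsub>W\<^esub> C (rev u) = inv\<^bsub>W\<^esub> C (s # a @ b)" by simp
  then have "C (rev (rev u)) = C (rev (s # a @ b))"
    using C_rev[of "rev u"] C_rev[of "s # a @ b"] s u V by simp
  then have "C ((rev b @ rev a) @ [s]) = C u" by simp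
  moreover have "length u = length (rev u)" by simp
  ultimately have "reduced ((rev b @ rev a) @ [s])"
    using s u V unfolding ayb(1) by (intro reduced_same_length[OF red]) simp_all
  with \<open>C ((rev b @ rev a) @ [s]) = C u\<close> show thesis by (rule that[rotated])
qed

text \<open>Either \<open>s\<close> can be appended to a reduced word of \<open>w\<close>, or \<open>w\<close> has a reduced word that ends
  in \<open>s\<close>.\<close>

lemma tits_right_mult:
  assumes "w \<in> carrier W" "s \<in> V"
  shows "tits_section \<Delta> (w \<otimes>\<^bsub>W\<^esub> C [s]) = tits_section \<Delta> w \<otimes>\<^bsub>G\<^esub> A [s] \<or>
    tits_section \<Delta> w = tits_section \<Delta> (w \<otimes>\<^bsub>W\<^esub> C [s]) \<otimes>\<^bsub>G\<^esub> A [s]"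
proof -
  obtain u where u: "reduced u" "w = C u" using carrier_reducedE[OF assms(1)] by blast
  note uV = reducedD(1)[OF u(1)]
  show ?thesis
  proof (cases "reduced (u @ [s])")
    case True
    then show ?thesis
      using tits_reduced[OF True] tits_reduced[OF u(1)] uV assms(2) u(2) by (simp add: C_append A_append)
  next
    case False
    then obtain v where v: "reduced (v @ [s])" "C (v @ [s]) = C u"
      using reduced_ending u assms(2) by metis
    have vV: "v \<in> lists V" using reducedD(1)[OF v(1)] by simp
    have "w \<otimes>\<^bsub>W\<^esub> C [s] = C ((v @ [s]) @ [s])"
      using vV assms(2) v(2) u(2) C_append[of "v @ [s]" "[s]"] by simp
    also have "\<dots> = C v" using C_delete_square[of s v "[]"] vV assms(2) by simp
    finally have "w \<otimes>\<^bsub>W\<^esub> C [s] = C v" .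
    moreover have "reduced v" using reduced_infix[of "[]" v "[s]"] v(1) by simp
    ultimately show ?thesis
      using tits_reduced[OF v(1)] tits_reduced[of v] v(2) u(2) vV assms(2) by (simp add: A_append)
  qed
qed

lemma tits_coset:
  assumes "w \<in> carrier W" "T \<subseteq> V" "u \<in> lists T"
  shows "tits_section \<Delta> (w \<otimes>\<^bsub>W\<^esub> C u) <#\<^bsub>G\<^esub> artin_parabolic \<Delta> T = tits_section \<Delta> w <#\<^bsub>G\<^esub> artin_parabolic \<Delta> T"
  using assms(1,3)
proof (induction u arbitrary: w)
  case Nil
  then show ?case by (simp add: C_Nil)
next
  case (Cons s u)
  let ?P = "artin_parabolic \<Delta> T" and ?\<tau> = "tits_section \<Delta>"
  have s: "s \<in> T" "s \<in> V" "u \<in> lists T" "u \<in> lists V"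
    using Cons.prems(2) assms(2) lists_mono[OF assms(2)] by auto
  define w' where "w' = w \<otimes>\<^bsub>W\<^esub> C [s]"
  have w': "w' \<in> carrier W" using Cons.prems(1) C_closed[of "[s]"] s by (simp add: w'_def)
  have "w \<otimes>\<^bsub>W\<^esub> C (s # u) = w' \<otimes>\<^bsub>W\<^esub> C u"
    using C_append[of "[s]" u] C_closed[of "[s]"] C_closed[of u] s Cons.prems(1)
    by (simp add: w'_def W.m_assoc)
  then have "?\<tau> (w \<otimes>\<^bsub>W\<^esub> C (s # u)) <#\<^bsub>G\<^esub> ?P = ?\<tau> w' <#\<^bsub>G\<^esub> ?P"
    using Cons.IH[OF w' s(3)] by simp
  also have "\<dots> = ?\<tau> w <#\<^bsub>G\<^esub> ?P"
  proof -
    have "A [s] \<in> ?P" using s(1) by (auto simp: artin_parabolic_def intro: generate.incl)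
    then have absorb: "g <#\<^bsub>G\<^esub> ?P = (g \<otimes>\<^bsub>G\<^esub> A [s]) <#\<^bsub>G\<^esub> ?P" if "g \<in> carrier G" for g
      using G.l_repr_independence[OF _ that artin_parabolic_subgroup[OF assms(2)], of "g \<otimes>\<^bsub>G\<^esub> A [s]"]
      by (auto simp: l_coset_def)
    from tits_right_mult[OF Cons.prems(1) s(2)] show ?thesis
      using absorb[OF tits_closed[OF Cons.prems(1)]] absorb[OF tits_closed[OF w']]
      unfolding w'_def[symmetric] by metis
  qed
  finally show ?case .
qed

text \<open>Equal cosets have the same type by \<open>coset_subset\<close>, and \<open>tits_coset\<close> makes the result
  independent of the representative.\<close>

lemma tits_vertex_map_coset:
  assumes w: "w \<in> carrier W" and T: "T \<in> spherical_subsets \<Delta>"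
  shows "tits_vertex_map \<Delta> (w <#\<^bsub>W\<^esub> coxeter_parabolic \<Delta> T) = tits_section \<Delta> w <#\<^bsub>G\<^esub> artin_parabolic \<Delta> T"
  unfolding tits_vertex_map_def
proof (rule the_equality)
  interpret fam: coset_family W "coxeter_parabolic \<Delta>" "spherical_subsets \<Delta>" by (rule davis_family)
  fix d assume "\<exists>w' T'. w' \<in> carrier W \<and> T' \<in> spherical_subsets \<Delta> \<and>
    w <#\<^bsub>W\<^esub> coxeter_parabolic \<Delta> T = w' <#\<^bsub>W\<^esub> coxeter_parabolic \<Delta> T' \<and>
    d = tits_section \<Delta> w' <#\<^bsub>G\<^esub> artin_parabolic \<Delta> T'"
  then obtain w' T' where w': "w' \<in> carrier W" and T': "T' \<in> spherical_subsets \<Delta>"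
    and eq: "w <#\<^bsub>W\<^esub> coxeter_parabolic \<Delta> T = w' <#\<^bsub>W\<^esub> coxeter_parabolic \<Delta> T'"
    and d: "d = tits_section \<Delta> w' <#\<^bsub>G\<^esub> artin_parabolic \<Delta> T'" by blast
  have TT': "T' = T"
    using fam.coset_subset(1)[OF T T' w w'] fam.coset_subset(1)[OF T' T w' w] eq by auto
  have "w' \<in> w <#\<^bsub>W\<^esub> coxeter_parabolic \<Delta> T"
    using W.lcos_self[OF w' fam.subgroup[OF T']] eq by simp
  then obtain h where "h \<in> coxeter_parabolic \<Delta> T" "w' = w \<otimes>\<^bsub>W\<^esub> h" by (auto simp: l_coset_def)
  then obtain u where "u \<in> lists T" "w' = w \<otimes>\<^bsub>W\<^esub> C u" using parabolic_words spherical_in[OF T] by metis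
  then show "d = tits_section \<Delta> w <#\<^bsub>G\<^esub> artin_parabolic \<Delta> T"
    using tits_coset[OF w spherical_in[OF T]] d TT' by simp
qed (use assms in blast)

lemma tits_morphism:
  "coset_morphism W (coxeter_parabolic \<Delta>) G (artin_parabolic \<Delta>) (spherical_subsets \<Delta>)
    (tits_vertex_map \<Delta>) (tits_section \<Delta>)"
  by (intro coset_morphism.intro coset_morphism_axioms.intro davis_family deligne_family
      tits_closed tits_vertex_map_coset)

theorem tits_inclusion_isometric:
  "isometric_embedding (davis_complex \<Delta>) (davis_dist \<Delta>)
    (deligne_complex \<Delta>) (deligne_dist \<Delta>) (tits_inclusion \<Delta>)"
  unfolding isometric_embedding_def
proof (intro conjI ballI)
  show "tits_inclusion \<Delta> \<in> davis_complex \<Delta> \<rightarrow> deligne_complex \<Delta>"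
    using coset_morphism.map_realisation[OF tits_morphism]
    by (simp add: tits_inclusion_def davis_complex_def deligne_complex_def)
  fix x y assume "x \<in> davis_complex \<Delta>" "y \<in> davis_complex \<Delta>"
  then show "deligne_dist \<Delta> (tits_inclusion \<Delta> x) (tits_inclusion \<Delta> y) = davis_dist \<Delta> x y"
    using moussong_dist_retract[OF tits_morphism projection_morphism proj_tits]
    by (simp add: tits_inclusion_def davis_complex_def deligne_dist_def davis_dist_def)
qed

end

lemma gromov_hyperbolic_isometric_embedding:
  assumes f: "isometric_embedding X d Y d' f" and Y: "gromov_hyperbolic Y d'"
  shows "gromov_hyperbolic X d"
proof -
  have fY: "f x \<in> Y" if "x \<in> X" for x using f that by (auto simp: isometric_embedding_def)
  have prod: "gromov_product d' (f w) (f x) (f y) = gromov_product d w x y"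
    if "w \<in> X" "x \<in> X" "y \<in> X" for w x y
    using f that by (simp add: isometric_embedding_def gromov_product_def)
  from Y obtain \<delta> where "\<delta> \<ge> 0" and \<delta>: "\<And>w x y z. \<lbrakk>w \<in> Y; x \<in> Y; y \<in> Y; z \<in> Y\<rbrakk> \<Longrightarrow>
    min (gromov_product d' w x y) (gromov_product d' w y z) - \<delta> \<le> gromov_product d' w x z"
    unfolding gromov_hyperbolic_def by blast
  have "min (gromov_product d w x y) (gromov_product d w y z) - \<delta> \<le> gromov_product d w x z"
    if "w \<in> X" "x \<in> X" "y \<in> X" "z \<in> X" for w x y z
    using \<delta>[of "f w" "f x" "f y" "f z"] that by (simp add: fY prod)
  with \<open>\<delta> \<ge> 0\<close> show ?thesis unfolding gromov_hyperbolic_def by blast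
qed

theorem proposition3p2:
  fixes \<Delta> :: "'v labelled_graph"
  assumes "defining_graph \<Delta>"
  shows "isometric_embedding (davis_complex \<Delta>) (davis_dist \<Delta>)
           (deligne_complex \<Delta>) (deligne_dist \<Delta>) (tits_inclusion \<Delta>) \<and>
         (gromov_hyperbolic (deligne_complex \<Delta>) (deligne_dist \<Delta>) \<longrightarrow>
           gromov_hyperbolic (davis_complex \<Delta>) (davis_dist \<Delta>))"
  using artin_system.tits_inclusion_isometric[OF artin_system.intro[OF assms]]
    gromov_hyperbolic_isometric_embedding by blast

end
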